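(* For every $\mu \in \mathcal{M}$ we have $\mathbb{B}_1(\mu) = \mathbb{B}(\mu)$, where $\mathbb{B}_1(\mu) = (\mu \boxplus \mu)^{\uplus 1/2}$ and $\mathbb{B} : \mathcal{M} \to \mathcal{M}_{\mathrm{inf-div}}$ is the Boolean Bercovici-Pata bijection.
   Context: $\mathcal{M}$ is the set of Borel probability measures on $\mathbb{R}$; $\mathbb{C}^+$ is the open upper half-plane. For $\mu \in \mathcal{M}$: $G_\mu(z) = \int_{\mathbb{R}} \frac{d\mu(s)}{z-s}$ is the Cauchy transform and $F_\mu(z) = 1/G_\mu(z)$ the reciprocal Cauchy transform; $F_\mu$ is an analytic self-map of $\mathbb{C}^+$. For every $\alpha>0$ there is $\beta>0$ such that $F_\mu$ has an analytic right inverse $F_\mu^{-1}$ on $\Gamma_{\alpha,\beta}=\{z\in\mathbb{C}^+ : |\Re z|<\alpha\,\Im z,\ \Im z>\beta\}$ with $F_\mu^{-1}(z)/z\to 1$ as $z\to\infty$ in $\Gamma_{\alpha,\beta}$; put $V_\mu(z) = F_\mu^{-1}(z)-z$ there. (In terms of the $R$-transform, $V_\mu(z) = zR_\mu(1/z)$.) Free additive convolution $\boxplus$ is determined by $V_{\mu\boxplus\nu} = V_\mu+V_\nu$ on a common truncated cone. For $t>0$, the Boolean convolution power $\mu^{\uplus t}\in\mathcal{M}$ is the unique probability measure with $F_{\mu^{\uplus t}}(z) = tF_\mu(z)+(1-t)z$, $z\in\mathbb{C}^+$. $\mathcal{M}_{\mathrm{inf-div}}$ is the set of $\mu\in\mathcal{M}$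 that are infinitely divisible with respect to $\boxplus$: for every $n\ge1$ there is $\mu_n\in\mathcal{M}$ with $\mu_n^{\boxplus n}=\mu$ ($n$-fold $\boxplus$-convolution). It is known that $\nu\in\mathcal{M}_{\mathrm{inf-div}}$ if and only if $V_\nu$ extends analytically to all of $\mathbb{C}^+$ with values in $\mathbb{C}^-\cup\mathbb{R}$. The Boolean Bercovici-Pata bijection $\mathbb{B}:\mathcal{M}\to\mathcal{M}_{\mathrm{inf-div}}$ sends $\mu$ to the unique $\nu\in\mathcal{M}_{\mathrm{inf-div}}$ such that $z-F_\mu(z) = V_\nu(z)$ for all $z\in\mathbb{C}^+$ (i.e. $z-F_\mu(z)=zR_\nu(1/z)$). *)

theory Defs
  imports "HOL-Probability.Probability" "HOL-Complex_Analysis.Complex_Analysis"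
begin

definition borel_probs :: "real measure set" where
  "borel_probs = {\<mu>. real_distribution \<mu>}"

definition upper_half_plane :: "complex set" where
  "upper_half_plane = {z. Im z > 0}"

definition cauchy_transform :: "real measure \<Rightarrow> complex \<Rightarrow> complex" where
  "cauchy_transform \<mu> z = (LINT s|\<mu>. 1 / (z - complex_of_real s))"

definition recip_cauchy :: "real measure \<Rightarrow> complex \<Rightarrow> complex" where
  "recip_cauchy \<mu> z = 1 / cauchy_transform \<mu> z"

definition truncated_cone :: "real \<Rightarrow> real \<Rightarrow> complex set" where
  "truncated_cone \<alpha> \<beta> = {z \<in> upper_half_plane. \<bar>Re z\<bar> < \<alpha> * Im z \<and> Im z > \<beta>}"

text \<open>
  The values of a right inverse must lie in the upper half-plane, since that is the domain of
  the reciprocal Cauchy transform; the HOL function is total.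
\<close>

definition right_inverse_on :: "real measure \<Rightarrow> real \<Rightarrow> real \<Rightarrow> (complex \<Rightarrow> complex) \<Rightarrow> bool" where
  "right_inverse_on \<mu> \<alpha> \<beta> f \<longleftrightarrow>
     f holomorphic_on truncated_cone \<alpha> \<beta> \<and>
     f ` truncated_cone \<alpha> \<beta> \<subseteq> upper_half_plane \<and>
     (\<forall>z\<in>truncated_cone \<alpha> \<beta>. recip_cauchy \<mu> (f z) = z) \<and>
     ((\<lambda>z. f z / z) \<longlongrightarrow> 1) (inf at_infinity (principal (truncated_cone \<alpha> \<beta>)))"

text \<open>
  The function \<open>V\<^sub>\<mu>\<close> is only determined on truncated cones on which the right inverse exists, so
  it is represented by the relation ``\<open>v\<close> coincides with \<open>V\<^sub>\<mu>\<close> on the given cone''. By the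
  normalisation at infinity and the identity theorem, \<open>v\<close> is unique on the cone, and the choices
  for different cones agree on their intersection.
\<close>

definition V_transform_on :: "real measure \<Rightarrow> real \<Rightarrow> real \<Rightarrow> (complex \<Rightarrow> complex) \<Rightarrow> bool" where
  "V_transform_on \<mu> \<alpha> \<beta> v \<longleftrightarrow>
     (\<exists>f. right_inverse_on \<mu> \<alpha> \<beta> f \<and> (\<forall>z\<in>truncated_cone \<alpha> \<beta>. v z = f z - z))"

definition V_transform_extension :: "real measure \<Rightarrow> (complex \<Rightarrow> complex) \<Rightarrow> bool" where
  "V_transform_extension \<mu> v \<longleftrightarrow>
     v holomorphic_on upper_half_plane \<and> (\<exists>\<alpha>>0. \<exists>\<beta>>0. V_transform_on \<mu> \<alpha> \<beta> v)"

definition is_free_conv :: "real measure \<Rightarrow> real measure \<Rightarrow> real measure \<Rightarrow> bool" where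
  "is_free_conv \<mu> \<nu> \<rho> \<longleftrightarrow>
     (\<exists>\<alpha>>0. \<exists>\<beta>>0. \<exists>u v w.
        V_transform_on \<mu> \<alpha> \<beta> u \<and> V_transform_on \<nu> \<alpha> \<beta> v \<and> V_transform_on \<rho> \<alpha> \<beta> w \<and>
        (\<forall>z\<in>truncated_cone \<alpha> \<beta>. w z = u z + v z))"

definition free_conv :: "real measure \<Rightarrow> real measure \<Rightarrow> real measure" (infixl "\<boxplus>" 65) where
  "\<mu> \<boxplus> \<nu> = (THE \<rho>. \<rho> \<in> borel_probs \<and> is_free_conv \<mu> \<nu> \<rho>)"

text \<open>The \<open>n\<close>-fold convolution of \<open>\<mu>\<close> with itself; only meaningful for \<open>n \<ge> 1\<close>.\<close>

definition free_conv_power :: "real measure \<Rightarrow> nat \<Rightarrow> real measure" where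
  "free_conv_power \<mu> n = ((\<lambda>\<rho>. \<rho> \<boxplus> \<mu>) ^^ (n - 1)) \<mu>"

definition free_inf_div :: "real measure set" where
  "free_inf_div = {\<mu> \<in> borel_probs. \<forall>n\<ge>1. \<exists>\<mu>\<^sub>n\<in>borel_probs. free_conv_power \<mu>\<^sub>n n = \<mu>}"

text \<open>Only meaningful for \<open>t > 0\<close>.\<close>

definition boolean_power :: "real measure \<Rightarrow> real \<Rightarrow> real measure" where
  "boolean_power \<mu> t =
     (THE \<rho>. \<rho> \<in> borel_probs \<and>
        (\<forall>z\<in>upper_half_plane.
           recip_cauchy \<rho> z = of_real t * recip_cauchy \<mu> z + of_real (1 - t) * z))"

text \<open>
  In the equation \<open>z - F\<^sub>\<mu>(z) = V\<^sub>\<nu>(z)\<close>, required on the whole upper half-plane, \<open>V\<^sub>\<nu>\<close> denotes the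
  analytic extension of the function given on a truncated cone.
\<close>

definition boolean_bercovici_pata :: "real measure \<Rightarrow> real measure" where
  "boolean_bercovici_pata \<mu> =
     (THE \<nu>. \<nu> \<in> free_inf_div \<and>
        (\<exists>v. V_transform_extension \<nu> v \<and>
             (\<forall>z\<in>upper_half_plane. z - recip_cauchy \<mu> z = v z)))"

definition B_one :: "real measure \<Rightarrow> real measure" where
  "B_one \<mu> = boolean_power (\<mu> \<boxplus> \<mu>) (1/2)"

end

theory Submission
  imports Defs "HOL-Real_Asymp.Real_Asymp"
begin

text \<open>
  Write \<open>F\<close> for the reciprocal Cauchy transform of \<open>\<mu>\<close>. For every \<open>c > 0\<close> the map
  \<open>H w = w + c * (w - F w)\<close> has a right inverse \<open>\<omega>\<close> on the whole upper half-plane: solutions of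
  \<open>H w = z\<close> are unique by the Schwarz-Pick inequality, and the set of those \<open>z\<close> that admit one
  is open and, because \<open>H\<close> is proper, closed. As \<open>Im (\<omega> z) \<ge> Im z\<close> and \<open>\<omega> z\<close> is asymptotic to \<open>z\<close>,
  \<open>\<omega>\<close> is itself the reciprocal Cauchy transform of some measure, whose \<open>V\<close>-transform is
  \<open>c * (z - F z)\<close> by construction. Taking \<open>c = 1 / n\<close> shows that the measure \<open>\<nu>\<close> belonging to \<open>c = 1\<close>
  is infinitely divisible, so it is the image of \<open>\<mu>\<close> under the bijection. On the other hand the
  \<open>\<omega>\<close> for \<open>c = 1\<close> is the subordination function of the free convolution square of \<open>\<mu>\<close>, whose reciprocal Cauchy
  transform is \<open>F (\<omega> z) = 2 * \<omega> z - z\<close>; its Boolean square root therefore has reciprocal Cauchy transform \<open>\<omega>\<close>,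
  that is, it equals \<open>\<nu>\<close>.
\<close>

section \<open>Cauchy transforms and the Schwarz-Pick inequality\<close>

text \<open>Free convolution, Boolean power and the bijection are definite descriptions, so each
  equation needs both a measure with the required property and a proof that it is the only one.
  Uniqueness always comes down to Stieltjes inversion: right inverses that agree on a cone force the
  Cauchy transforms to agree on a nonempty open set, hence on the half-plane, and they determine the
  measure. The obstacle to existence is that \<mu> need not have moments. Near infinity one only
  knows that z - F z is o(z) inside cones and has a small Lipschitz constant there; this gives
  solutions by contraction high up in a cone, and everything global rests on Schwarz-Pick. A measure
  is produced from a function F by inverting 1/F along the line Im z = \<epsilon>, where it is
  analytic, and passing to a weak limit as \<epsilon> tends to 0; the normalisation of F at infinity
  keeps mass from escaping.\<close>

lemma upper_half_plane_iff: "z \<in> upper_half_plane \<longleftrightarrow> Im z > 0"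
  by (simp add: upper_half_plane_def)

lemma open_upper_half_plane: "open upper_half_plane"
  unfolding upper_half_plane_def by (rule open_halfspace_Im_gt)

lemma convex_upper_half_plane: "convex upper_half_plane"
  unfolding upper_half_plane_def by (rule convex_halfspace_Im_gt)

lemma Im_le_cmod_minus_real: "Im z \<le> cmod (z - complex_of_real s)"
  using abs_Im_le_cmod[of "z - complex_of_real s"] by simp

lemma minus_real_nonzero: "Im z > 0 \<Longrightarrow> z - complex_of_real s \<noteq> 0"
  using Im_le_cmod_minus_real[of z s] by auto

lemma norm_cauchy_kernel_le: "Im z > 0 \<Longrightarrow> cmod (1 / (z - complex_of_real s)) \<le> 1 / Im z"
  using Im_le_cmod_minus_real[of z s] by (simp add: norm_divide frac_le)

context real_distribution
begin

lemma prob_UNIV: "prob UNIV = 1"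
  using prob_space by simp

lemma integrable_bounded:
  fixes f :: "real \<Rightarrow> 'b::{banach, second_countable_topology}"
  assumes "f \<in> borel_measurable borel" "\<And>s. norm (f s) \<le> B"
  shows "integrable M f"
  using assms by (intro integrable_const_bound[where B=B]) auto

lemma integrable_cauchy_kernel:
  assumes "Im z > 0"
  shows "integrable M (\<lambda>s. 1 / (z - complex_of_real s))"
  using norm_cauchy_kernel_le[OF assms] by (intro integrable_bounded) auto

lemma norm_cauchy_kernel2_le:
  assumes "Im z > 0" "Im w > 0"
  shows "cmod (1 / ((z - complex_of_real s) * (w - complex_of_real s))) \<le> 1 / Im z * (1 / Im w)"
proof -
  have "cmod (1 / ((z - complex_of_real s) * (w - complex_of_real s)))
      = cmod (1 / (z - complex_of_real s)) * cmod (1 / (w - complex_of_real s))"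
    by (simp add: norm_divide norm_mult)
  also have "\<dots> \<le> 1 / Im z * (1 / Im w)"
    using assms by (intro mult_mono norm_cauchy_kernel_le) auto
  finally show ?thesis .
qed

lemma integrable_cauchy_kernel2:
  assumes "Im z > 0" "Im w > 0"
  shows "integrable M (\<lambda>s. 1 / ((z - complex_of_real s) * (w - complex_of_real s)))"
  using norm_cauchy_kernel2_le[OF assms] by (intro integrable_bounded) auto

text \<open>The resolvent identity, integrated. The two-point integral is used as a difference
  quotient for the derivative, under Cauchy-Schwarz for Schwarz-Pick, and for the Lipschitz estimate
  in cones.\<close>

lemma cauchy_transform_diff:
  assumes "Im z > 0" "Im w > 0"
  shows "cauchy_transform M z - cauchy_transform M w
       = (w - z) * (LINT s|M. 1 / ((z - complex_of_real s) * (w - complex_of_real s)))"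
proof -
  have "cauchy_transform M z - cauchy_transform M w
      = (LINT s|M. 1 / (z - complex_of_real s) - 1 / (w - complex_of_real s))"
    unfolding cauchy_transform_def
    using assms by (intro Bochner_Integration.integral_diff[symmetric] integrable_cauchy_kernel)
  also have "\<dots> = (LINT s|M. (w - z) * (1 / ((z - complex_of_real s) * (w - complex_of_real s))))"
    using minus_real_nonzero[OF assms(1)] minus_real_nonzero[OF assms(2)]
    by (intro Bochner_Integration.integral_cong) (auto simp: field_simps)
  finally show ?thesis by (simp only: integral_mult_right_zero)
qed

lemma norm_cauchy_transform_le:
  assumes "Im z > 0"
  shows "cmod (cauchy_transform M z) \<le> 1 / Im z"
proof -
  have "cmod (cauchy_transform M z) \<le> (LINT s|M. cmod (1 / (z - complex_of_real s)))"
    unfolding cauchy_transform_def by (rule integral_norm_bound)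
  also have "\<dots> \<le> (LINT s|M. 1 / Im z)"
    using assms by (intro integral_mono integrable_norm integrable_cauchy_kernel norm_cauchy_kernel_le) auto
  finally show ?thesis by (simp add: prob_UNIV)
qed

lemma cauchy_transform_has_field_derivative:
  assumes z: "Im z > 0"
  shows "(cauchy_transform M has_field_derivative
            - (LINT s|M. 1 / ((z - complex_of_real s) * (z - complex_of_real s)))) (at z)"
proof -
  let ?I = "\<lambda>w. LINT s|M. 1 / ((w - complex_of_real s) * (z - complex_of_real s))"
  have "(\<lambda>n. ?I (X n)) \<longlonglongrightarrow> ?I z" if X: "X \<longlonglongrightarrow> z" for X :: "nat \<Rightarrow> complex"
  proof -
    have "\<forall>\<^sub>F n in sequentially. Im (X n) > Im z / 2"
      using order_tendstoD(1)[OF tendsto_Im[OF X], of "Im z / 2"] z by simp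
    \<comment> \<open>From \<open>N\<close> on the sequence stays above height
      \<open>Im z / 2\<close>, so a single constant dominates all the kernels.\<close>
    then obtain N where N: "\<And>n. n \<ge> N \<Longrightarrow> Im (X n) > Im z / 2"
      by (auto simp: eventually_sequentially)
    have "(\<lambda>n. ?I (X (n + N))) \<longlonglongrightarrow> ?I z"
    proof (rule integral_dominated_convergence[where w="\<lambda>_. 1 / (Im z / 2) * (1 / Im z)"])
      show "AE s in M. (\<lambda>n. 1 / ((X (n + N) - complex_of_real s) * (z - complex_of_real s)))
             \<longlonglongrightarrow> 1 / ((z - complex_of_real s) * (z - complex_of_real s))"
        using minus_real_nonzero[OF z]
        by (intro AE_I2 tendsto_intros LIMSEQ_ignore_initial_segment[OF X]) auto
      show "AE s in M. cmod (1 / ((X (n + N) - complex_of_real s) * (z - complex_of_real s)))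
             \<le> 1 / (Im z / 2) * (1 / Im z)" for n
      proof (rule AE_I2)
        fix s
        have *: "Im (X (n + N)) > Im z / 2" by (rule N) simp
        then have "cmod (1 / ((X (n + N) - complex_of_real s) * (z - complex_of_real s)))
             \<le> 1 / Im (X (n + N)) * (1 / Im z)"
          using z by (intro norm_cauchy_kernel2_le) auto
        also have "\<dots> \<le> 1 / (Im z / 2) * (1 / Im z)"
          using * z by (intro mult_right_mono frac_le) auto
        finally show "cmod (1 / ((X (n + N) - complex_of_real s) * (z - complex_of_real s)))
             \<le> 1 / (Im z / 2) * (1 / Im z)" .
      qed
    qed auto
    then show ?thesis by (rule LIMSEQ_offset)
  qed
  then have "(?I \<longlongrightarrow> ?I z) (at z)"
    by (auto simp: tendsto_at_iff_sequentially comp_def)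
  then have lim: "((\<lambda>w. - ?I w) \<longlongrightarrow> - ?I z) (at z)" by (rule tendsto_minus)
  have "\<forall>\<^sub>F w in at z. w \<in> {w. Im w > 0}"
    using z by (intro eventually_at_topological[THEN iffD2] exI[of _ "{w. Im w > 0}"])
      (auto simp: open_halfspace_Im_gt)
  then have "\<forall>\<^sub>F w in at z. - ?I w = (cauchy_transform M w - cauchy_transform M z) / (w - z)"
    using eventually_neq_at_within[of z]
  proof eventually_elim
    case (elim w)
    then show ?case using cauchy_transform_diff[of w z] z by (simp add: field_simps)
  qed
  with lim show ?thesis
    unfolding has_field_derivative_iff by (rule Lim_transform_eventually)
qed

lemma holomorphic_cauchy_transform: "cauchy_transform M holomorphic_on upper_half_plane"
  using cauchy_transform_has_field_derivative
  by (fastforce simp: holomorphic_on_open open_upper_half_plane upper_half_plane_iff)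

lemma integrable_cauchy_kernel_sq:
  assumes "Im z > 0"
  shows "integrable M (\<lambda>s. (cmod (1 / (z - complex_of_real s)))\<^sup>2)"
proof (rule integrable_bounded[where B="(1 / Im z)\<^sup>2"])
  show "norm ((cmod (1 / (z - complex_of_real s)))\<^sup>2) \<le> (1 / Im z)\<^sup>2" for s
    using norm_cauchy_kernel_le[OF assms, of s] by (simp add: power_mono del: power_divide power_one_over)
qed auto

lemma Im_cauchy_transform:
  assumes "Im z > 0"
  shows "Im (cauchy_transform M z) = - (Im z * (LINT s|M. (cmod (1 / (z - complex_of_real s)))\<^sup>2))"
proof -
  have "Im (1 / (z - complex_of_real s)) = - (Im z * (cmod (1 / (z - complex_of_real s)))\<^sup>2)" for s
    by (simp add: Im_divide norm_divide power_divide cmod_power2)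
  then have "(LINT s|M. Im (1 / (z - complex_of_real s)))
      = (LINT s|M. - (Im z * (cmod (1 / (z - complex_of_real s)))\<^sup>2))"
    by presburger
  then show ?thesis
    unfolding cauchy_transform_def by (simp add: integral_Im integrable_cauchy_kernel assms)
qed

lemma cauchy_kernel_sq_pos:
  assumes "Im z > 0"
  shows "(LINT s|M. (cmod (1 / (z - complex_of_real s)))\<^sup>2) > 0"
proof -
  have "(LINT s|M. (cmod (1 / (z - complex_of_real s)))\<^sup>2) \<noteq> 0"
  proof
    assume "(LINT s|M. (cmod (1 / (z - complex_of_real s)))\<^sup>2) = 0"
    then have "AE s in M. (cmod (1 / (z - complex_of_real s)))\<^sup>2 = 0"
      using integral_nonneg_eq_0_iff_AE[OF integrable_cauchy_kernel_sq[OF assms]] by simp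
    then have "AE s in M. False"
      using minus_real_nonzero[OF assms] by simp
    then show False by simp
  qed
  moreover have "(LINT s|M. (cmod (1 / (z - complex_of_real s)))\<^sup>2) \<ge> 0"
    by (intro integral_nonneg_AE) auto
  ultimately show ?thesis by linarith
qed

lemma Im_cauchy_transform_neg: "Im z > 0 \<Longrightarrow> Im (cauchy_transform M z) < 0"
  by (simp only: Im_cauchy_transform cauchy_kernel_sq_pos neg_less_0_iff_less mult_pos_pos)

lemma cauchy_transform_nonzero: "Im z > 0 \<Longrightarrow> cauchy_transform M z \<noteq> 0"
  using Im_cauchy_transform_neg[of z] by auto

lemma holomorphic_recip_cauchy: "recip_cauchy M holomorphic_on upper_half_plane"
  unfolding recip_cauchy_def
  using holomorphic_cauchy_transform cauchy_transform_nonzero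
  by (intro holomorphic_intros) (auto simp: upper_half_plane_iff)

text \<open>Since Im (1 / G) = - Im G / |G|^2, the ratio Im F / Im z is the second absolute moment
  of the kernel divided by the squared modulus of its mean. This turns estimates on F into instances
  of Cauchy-Schwarz.\<close>

lemma Im_recip_cauchy:
  assumes "Im z > 0"
  shows "Im (recip_cauchy M z)
     = Im z * (LINT s|M. (cmod (1 / (z - complex_of_real s)))\<^sup>2) / (cmod (cauchy_transform M z))\<^sup>2"
  using Im_cauchy_transform[OF assms]
  by (simp add: recip_cauchy_def Im_divide cmod_power2)

text \<open>The weighted inequality between arithmetic and geometric means, integrated; the weights
  are the quotients of the two L2 norms \<open>a\<close> and \<open>b\<close>, which are positive by
  \<open>pos\<close>.\<close>

lemma cauchy_schwarz_integral:
  fixes f g :: "real \<Rightarrow> complex"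
  assumes f: "f \<in> borel_measurable borel" "integrable M (\<lambda>s. (cmod (f s))\<^sup>2)"
    and g: "g \<in> borel_measurable borel" "integrable M (\<lambda>s. (cmod (g s))\<^sup>2)"
    and pos: "(LINT s|M. (cmod (f s))\<^sup>2) > 0" "(LINT s|M. (cmod (g s))\<^sup>2) > 0"
  shows "(cmod (LINT s|M. f s * g s))\<^sup>2 \<le> (LINT s|M. (cmod (f s))\<^sup>2) * (LINT s|M. (cmod (g s))\<^sup>2)"
proof -
  let ?A = "LINT s|M. (cmod (f s))\<^sup>2" and ?B = "LINT s|M. (cmod (g s))\<^sup>2"
  define a b where "a = sqrt ?A" and "b = sqrt ?B"
  have ab: "a > 0" "b > 0" "a\<^sup>2 = ?A" "b\<^sup>2 = ?B" using pos by (auto simp: a_def b_def)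
  have amgm: "cmod (f s * g s) \<le> (b / a * (cmod (f s))\<^sup>2 + a / b * (cmod (g s))\<^sup>2) / 2" for s
  proof -
    have "0 \<le> (b * cmod (f s) - a * cmod (g s))\<^sup>2 / (a * b)" using ab by simp
    also have "\<dots> = b / a * (cmod (f s))\<^sup>2 + a / b * (cmod (g s))\<^sup>2 - 2 * cmod (f s * g s)"
      using ab by (simp add: field_simps power2_eq_square norm_mult)
    finally show ?thesis by simp
  qed
  have "cmod (LINT s|M. f s * g s) \<le> (LINT s|M. (b / a * (cmod (f s))\<^sup>2 + a / b * (cmod (g s))\<^sup>2) / 2)"
  proof (rule Bochner_Integration.integral_norm_bound_integral)
    show int: "integrable M (\<lambda>s. (b / a * (cmod (f s))\<^sup>2 + a / b * (cmod (g s))\<^sup>2) / 2)"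
      using f g by auto
    show "integrable M (\<lambda>s. f s * g s)"
    proof (rule Bochner_Integration.integrable_bound[OF int])
      show "AE s in M. norm (f s * g s) \<le> norm ((b / a * (cmod (f s))\<^sup>2 + a / b * (cmod (g s))\<^sup>2) / 2)"
        using amgm by (intro AE_I2) (metis abs_ge_self order_trans real_norm_def)
    qed (use f g in auto)
  qed (use amgm in auto)
  also have "\<dots> = (b / a * a\<^sup>2 + a / b * b\<^sup>2) / 2"
    using f g ab(3,4) by simp
  also have "\<dots> = a * b"
    using ab(1,2) by (simp add: field_simps power2_eq_square)
  finally have "(cmod (LINT s|M. f s * g s))\<^sup>2 \<le> (a * b)\<^sup>2" by (intro power_mono) auto
  then show ?thesis using ab by (simp add: power_mult_distrib)
qed

text \<open>For Cauchy transforms, Schwarz-Pick is an instance of Cauchy-Schwarz.\<close>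
lemma recip_cauchy_schwarz_pick:
  assumes z: "Im z > 0" and w: "Im w > 0"
  shows "(cmod (recip_cauchy M z - recip_cauchy M w))\<^sup>2 * (Im z * Im w)
       \<le> (cmod (z - w))\<^sup>2 * (Im (recip_cauchy M z) * Im (recip_cauchy M w))"
proof -
  define G where "G = cauchy_transform M"
  define L where "L = (LINT s|M. 1 / (z - complex_of_real s) * (1 / (w - complex_of_real s)))"
  define A where "A z = (LINT s|M. (cmod (1 / (z - complex_of_real s)))\<^sup>2)" for z
  have nz: "G z \<noteq> 0" "G w \<noteq> 0" unfolding G_def using z w by (auto simp: cauchy_transform_nonzero)
  have L: "(cmod L)\<^sup>2 \<le> A z * A w"
    unfolding L_def A_def using z w
    by (intro cauchy_schwarz_integral integrable_cauchy_kernel_sq cauchy_kernel_sq_pos) auto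
  have "G z - G w = (w - z) * L" using cauchy_transform_diff[OF z w] by (simp add: G_def L_def)
  then have "recip_cauchy M z - recip_cauchy M w = (z - w) * L / (G z * G w)"
    using nz unfolding recip_cauchy_def G_def[symmetric] by (simp add: field_simps)
  then have "(cmod (recip_cauchy M z - recip_cauchy M w))\<^sup>2
      = (cmod (z - w))\<^sup>2 * (cmod L)\<^sup>2 / ((cmod (G z))\<^sup>2 * (cmod (G w))\<^sup>2)"
    by (simp add: norm_mult norm_divide power_mult_distrib power_divide)
  also have "\<dots> \<le> (cmod (z - w))\<^sup>2 * (A z * A w) / ((cmod (G z))\<^sup>2 * (cmod (G w))\<^sup>2)"
    using L by (intro divide_right_mono mult_left_mono) auto
  finally have "(cmod (recip_cauchy M z - recip_cauchy M w))\<^sup>2 * (Im z * Im w)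
     \<le> (cmod (z - w))\<^sup>2 * (A z * A w) / ((cmod (G z))\<^sup>2 * (cmod (G w))\<^sup>2) * (Im z * Im w)"
    using z w by (intro mult_right_mono) auto
  also have "\<dots> = (cmod (z - w))\<^sup>2 * ((Im z * A z / (cmod (G z))\<^sup>2) * (Im w * A w / (cmod (G w))\<^sup>2))"
    by (simp add: field_simps)
  finally show ?thesis using Im_recip_cauchy[OF z] Im_recip_cauchy[OF w] by (simp add: A_def G_def)
qed

text \<open>Cauchy-Schwarz for the kernel against the constant 1: the squared modulus of the mean is
  at most the second absolute moment.\<close>

lemma Im_recip_cauchy_ge:
  assumes z: "Im z > 0"
  shows "Im (recip_cauchy M z) \<ge> Im z"
proof -
  define G where "G = cauchy_transform M z"
  define A where "A = (LINT s|M. (cmod (1 / (z - complex_of_real s)))\<^sup>2)"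
  have nz: "G \<noteq> 0" unfolding G_def using z by (auto simp: cauchy_transform_nonzero)
  have "(cmod (LINT s|M. 1 / (z - complex_of_real s) * 1))\<^sup>2 \<le> A * (LINT s|M. (cmod (1::complex))\<^sup>2)"
    unfolding A_def using z
    by (intro cauchy_schwarz_integral integrable_cauchy_kernel_sq cauchy_kernel_sq_pos)
      (auto simp: prob_UNIV)
  then have "(cmod G)\<^sup>2 \<le> A" by (simp add: G_def cauchy_transform_def prob_UNIV)
  then have "1 \<le> A / (cmod G)\<^sup>2" using nz by (simp add: field_simps)
  then have "Im z * 1 \<le> Im z * (A / (cmod G)\<^sup>2)" using z by (intro mult_left_mono) auto
  then show ?thesis using Im_recip_cauchy[OF z] by (simp add: A_def G_def)
qed

end

section \<open>Non-tangential behaviour at infinity\<close>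

lemma truncated_cone_iff:
  "z \<in> truncated_cone \<alpha> \<beta> \<longleftrightarrow> Im z > 0 \<and> \<bar>Re z\<bar> < \<alpha> * Im z \<and> Im z > \<beta>"
  by (auto simp: truncated_cone_def upper_half_plane_def)

lemma cmod_le_in_truncated_cone:
  assumes "z \<in> truncated_cone \<alpha> \<beta>"
  shows "cmod z \<le> (1 + \<alpha>) * Im z"
  using cmod_le[of z] assms by (simp add: truncated_cone_iff algebra_simps)

lemma truncated_cone_mono:
  assumes "\<alpha> \<le> \<alpha>'" "\<beta>' \<le> \<beta>"
  shows "truncated_cone \<alpha> \<beta> \<subseteq> truncated_cone \<alpha>' \<beta>'"
proof
  fix z assume "z \<in> truncated_cone \<alpha> \<beta>"
  then have z: "Im z > 0" "\<bar>Re z\<bar> < \<alpha> * Im z" "Im z > \<beta>" by (auto simp: truncated_cone_iff)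
  then have "\<alpha> * Im z \<le> \<alpha>' * Im z" using assms by (intro mult_right_mono) auto
  then show "z \<in> truncated_cone \<alpha>' \<beta>'" unfolding truncated_cone_iff using z assms by linarith
qed

text \<open>In the cone |z| is at most (1 + \<alpha>) Im z, so a move by r |z| changes each
  coordinate by at most half of Im z. The height is at worst halved, and \<alpha> Im z + Im z / 2 =
  (2 \<alpha> + 1) (Im z / 2), which explains the aperture 2 \<alpha> + 1 that recurs below.\<close>

lemma truncated_cone_neighbour:
  assumes z: "z \<in> truncated_cone \<alpha> \<beta>" and "0 < \<alpha>" "0 \<le> \<beta>" and r: "r * (1 + \<alpha>) \<le> 1 / 2" "0 \<le> r"
    and w: "cmod (w - z) \<le> r * cmod z"
  shows "w \<in> truncated_cone (2 * \<alpha> + 1) (\<beta> / 2)"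
proof -
  have z': "Im z > 0" "\<bar>Re z\<bar> < \<alpha> * Im z" "Im z > \<beta>" using z by (auto simp: truncated_cone_iff)
  have "r * cmod z \<le> r * ((1 + \<alpha>) * Im z)"
    using r cmod_le_in_truncated_cone[OF z] by (intro mult_left_mono)
  also have "\<dots> \<le> 1 / 2 * Im z" using r z' unfolding mult.assoc[symmetric] by (intro mult_right_mono) auto
  finally have le: "cmod (w - z) \<le> Im z / 2" using w by simp
  have I: "Im w \<ge> Im z / 2" using abs_Im_le_cmod[of "w - z"] le by simp
  have "\<bar>Re w\<bar> \<le> \<bar>Re z\<bar> + Im z / 2" using abs_Re_le_cmod[of "w - z"] le by simp
  also have "\<dots> < (2 * \<alpha> + 1) * (Im z / 2)" using z' by (simp add: algebra_simps)
  also have "\<dots> \<le> (2 * \<alpha> + 1) * Im w" using I \<open>0 < \<alpha>\<close> by (intro mult_left_mono) auto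
  finally show ?thesis using I z' \<open>0 \<le> \<beta>\<close> by (simp add: truncated_cone_iff)
qed

context real_distribution
begin

text \<open>In a cone z / (z - s) - 1 = s / (z - s) is bounded by the constant 2 + \<alpha> and also
  by |s| / Im z. The minimum of the two bounds is a majorant depending only on the height, and its
  integral tends to 0 by dominated convergence without any moment of M.\<close>

lemma cauchy_kernel_nontangential:
  assumes "\<alpha> > 0" "\<epsilon> > 0"
  shows "\<exists>\<beta>>0. \<forall>z\<in>truncated_cone \<alpha> \<beta>. \<forall>w\<in>truncated_cone \<alpha> \<beta>.
     cmod (z * w * (LINT s|M. 1 / ((z - complex_of_real s) * (w - complex_of_real s))) - 1) \<le> \<epsilon> \<and>
     cmod (z * cauchy_transform M z - 1) \<le> \<epsilon>"
proof -
  define k where "k = 2 + \<alpha>"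
  have k: "k > 0" using assms by (simp add: k_def)
  have "(\<lambda>n. LINT s|M. min k (\<bar>s\<bar> / real (Suc n))) \<longlonglongrightarrow> (LINT s|M. min k 0)"
  proof (rule integral_dominated_convergence[where w="\<lambda>_. k"])
    have "(\<lambda>n. \<bar>s\<bar> * inverse (real (Suc n))) \<longlonglongrightarrow> \<bar>s\<bar> * 0" for s
      by (intro tendsto_intros LIMSEQ_inverse_real_of_nat)
    then have "(\<lambda>n. min k (\<bar>s\<bar> / real (Suc n))) \<longlonglongrightarrow> min k 0" for s
      by (intro tendsto_intros) (simp add: field_simps)
    then show "AE s in M. (\<lambda>n. min k (\<bar>s\<bar> / real (Suc n))) \<longlonglongrightarrow> min k 0" by simp
  qed (use k in auto)
  moreover have "\<epsilon> / (2 + k) > 0" using k assms by simp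
  ultimately have "\<forall>\<^sub>F n in sequentially. (LINT s|M. min k (\<bar>s\<bar> / real (Suc n))) < \<epsilon> / (2 + k)"
    using k by (intro order_tendstoD) auto
  then obtain n where n: "(LINT s|M. min k (\<bar>s\<bar> / real (Suc n))) < \<epsilon> / (2 + k)"
    by (meson eventually_sequentially order_refl)
  define m where "m s = min k (\<bar>s\<bar> / real (Suc n))" for s
  have m0: "m s \<ge> 0" "m s \<le> k" for s using k by (auto simp: m_def)
  have m_int: "integrable M m"
    using m0 by (intro integrable_bounded[where B=k]) (auto simp: m_def[abs_def])
  have small: "(2 + k) * (LINT s|M. m s) \<le> \<epsilon>"
    using n k by (simp add: m_def field_simps)
  have bound: "cmod (z / (z - complex_of_real s) - 1) \<le> m s"
    if z: "z \<in> truncated_cone \<alpha> (real (Suc n))" for z s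
  proof -
    have z': "Im z > 0" "Im z > real (Suc n)" using z by (auto simp: truncated_cone_iff)
    have pos: "cmod (z - complex_of_real s) > 0" using minus_real_nonzero[OF z'(1)] by simp
    have "cmod (z / (z - complex_of_real s)) \<le> (1 + \<alpha>) * Im z / Im z"
      unfolding norm_divide using z' cmod_le_in_truncated_cone[OF z] Im_le_cmod_minus_real[of z s] assms
      by (intro frac_le) auto
    then have "cmod (z / (z - complex_of_real s) - 1) \<le> k"
      using norm_triangle_ineq4[of "z / (z - complex_of_real s)" 1] z' by (simp add: k_def)
    moreover have "z / (z - complex_of_real s) - 1 = of_real s / (z - complex_of_real s)"
      using minus_real_nonzero[OF z'(1)] by (simp add: field_simps)
    then have "cmod (z / (z - complex_of_real s) - 1) \<le> \<bar>s\<bar> / real (Suc n)"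
      using z' Im_le_cmod_minus_real[of z s] by (simp add: norm_divide frac_le)
    ultimately show ?thesis by (simp add: m_def)
  qed
  show ?thesis
  proof (intro exI[of _ "real (Suc n)"] conjI ballI)
    fix z w assume z: "z \<in> truncated_cone \<alpha> (real (Suc n))" and w: "w \<in> truncated_cone \<alpha> (real (Suc n))"
    have Im: "Im z > 0" "Im w > 0" using z w by (auto simp: truncated_cone_iff)
    have "z * cauchy_transform M z - 1 = (LINT s|M. z * (1 / (z - complex_of_real s)) - 1)"
      using integrable_cauchy_kernel[OF Im(1)] unfolding cauchy_transform_def
      by (subst Bochner_Integration.integral_diff) (auto simp: prob_UNIV simp del: times_divide_eq_right)
    also have "cmod \<dots> \<le> (LINT s|M. m s)"
      using bound[OF z] m_int integrable_cauchy_kernel[OF Im(1)]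
      by (intro Bochner_Integration.integral_norm_bound_integral
          Bochner_Integration.integrable_diff integrable_mult_right) auto
    also have "\<dots> \<le> (2 + k) * (LINT s|M. m s)"
      using k Bochner_Integration.integral_nonneg[of M m] m0 by (simp add: mult_le_cancel_right1 not_less)
    finally show "cmod (z * cauchy_transform M z - 1) \<le> \<epsilon>" using small by simp
    have b2: "cmod (z * w * (1 / ((z - complex_of_real s) * (w - complex_of_real s))) - 1) \<le> (2 + k) * m s" for s
    proof -
      define a b where "a = z / (z - complex_of_real s) - 1" and "b = w / (w - complex_of_real s) - 1"
      \<comment> \<open>With 1 + a and 1 + b for the two factors, the product minus 1 is a + b + a
        b. Bounding one factor of a b by \<open>k\<close> and the other by \<open>m s\<close> gives
        the constant \<open>2 + k\<close> for which \<open>n\<close> was chosen.\<close>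
      have "z * w * (1 / ((z - complex_of_real s) * (w - complex_of_real s))) - 1 = a + b + a * b"
        by (simp add: a_def b_def algebra_simps)
      also have "cmod \<dots> \<le> cmod a + cmod b + cmod a * cmod b"
        using norm_triangle_ineq[of "a + b" "a * b"] norm_triangle_ineq[of a b] unfolding norm_mult by linarith
      also have "\<dots> \<le> m s + m s + k * m s"
        using bound[OF z, of s] bound[OF w, of s] m0[of s] by (intro add_mono mult_mono) (auto simp: a_def b_def)
      finally show ?thesis by (simp add: algebra_simps)
    qed
    have "z * w * (LINT s|M. 1 / ((z - complex_of_real s) * (w - complex_of_real s))) - 1
        = (LINT s|M. z * w * (1 / ((z - complex_of_real s) * (w - complex_of_real s))) - 1)"
      using integrable_cauchy_kernel2[OF Im]
      by (subst Bochner_Integration.integral_diff) (auto simp: prob_UNIV simp del: times_divide_eq_right times_divide_eq_left)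
    also have "cmod \<dots> \<le> (LINT s|M. (2 + k) * m s)"
      using b2 m_int integrable_cauchy_kernel2[OF Im]
      by (intro Bochner_Integration.integral_norm_bound_integral
          Bochner_Integration.integrable_diff integrable_mult_right) auto
    finally show "cmod (z * w * (LINT s|M. 1 / ((z - complex_of_real s) * (w - complex_of_real s))) - 1) \<le> \<epsilon>"
      using small by simp
  qed simp
qed

text \<open>With p = z G(z), q = w G(w) and l = z w L, all close to 1, the two quantities are z (p -
  1) / p and (z - w) (p q - l) / (p q). The second bound comes straight from the resolvent identity
  and later serves as contraction constant and as proof of injectivity.\<close>

lemma recip_cauchy_nontangential:
  assumes "\<alpha> > 0" "\<epsilon> > 0"
  shows "\<exists>\<beta>>0. \<forall>z\<in>truncated_cone \<alpha> \<beta>. \<forall>w\<in>truncated_cone \<alpha> \<beta>.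
     cmod (z - recip_cauchy M z) \<le> \<epsilon> * cmod z \<and>
     cmod ((z - recip_cauchy M z) - (w - recip_cauchy M w)) \<le> \<epsilon> * cmod (z - w)"
proof -
  \<comment> \<open>The cap 1/2 keeps |p| and |q| above 1/2; the 16 pays for a numerator of at most
    4 e over a denominator of at least 1/4.\<close>
  define e where "e = min (1/2) (\<epsilon> / 16)"
  have e: "e > 0" "e \<le> 1 / 2" "16 * e \<le> \<epsilon>" using assms by (auto simp: e_def)
  obtain \<beta> where \<beta>: "\<beta> > 0" and *: "\<And>z w. z \<in> truncated_cone \<alpha> \<beta> \<Longrightarrow> w \<in> truncated_cone \<alpha> \<beta> \<Longrightarrow>
     cmod (z * w * (LINT s|M. 1 / ((z - complex_of_real s) * (w - complex_of_real s))) - 1) \<le> e \<and>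
     cmod (z * cauchy_transform M z - 1) \<le> e"
    using cauchy_kernel_nontangential[OF assms(1) e(1)] by blast
  show ?thesis
  proof (intro exI[of _ \<beta>] conjI ballI \<beta>)
    fix z w assume z: "z \<in> truncated_cone \<alpha> \<beta>" and w: "w \<in> truncated_cone \<alpha> \<beta>"
    have Im: "Im z > 0" "Im w > 0" using z w by (auto simp: truncated_cone_iff)
    then have nz: "z \<noteq> 0" "w \<noteq> 0" by auto
    define G where "G = cauchy_transform M"
    define L where "L = (LINT s|M. 1 / ((z - complex_of_real s) * (w - complex_of_real s)))"
    define p q l where "p = z * G z" "q = w * G w" "l = z * w * L"
    have G: "G z \<noteq> 0" "G w \<noteq> 0" using Im by (auto simp: G_def cauchy_transform_nonzero)
    have pq: "cmod (p - 1) \<le> e" "cmod (q - 1) \<le> e" "cmod (l - 1) \<le> e"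
      using *[OF z w] *[OF w z] by (auto simp: p_q_l_def L_def G_def)
    have half: "cmod p \<ge> 1 / 2" "cmod q \<ge> 1 / 2" "cmod q \<le> 3 / 2"
      using pq e norm_triangle_ineq2[of 1 "1 - p"] norm_triangle_ineq2[of 1 "1 - q"]
        norm_triangle_ineq[of 1 "q - 1"] by (auto simp: norm_minus_commute)
    have "z - recip_cauchy M z = z * (p - 1) / p"
      using nz G by (simp add: recip_cauchy_def p_q_l_def G_def[symmetric] field_simps)
    then have "cmod (z - recip_cauchy M z) = cmod z * cmod (p - 1) / cmod p"
      by (simp add: norm_mult norm_divide)
    also have "\<dots> \<le> cmod z * e / (1 / 2)"
      using half pq e by (intro frac_le mult_left_mono) auto
    also have "\<dots> \<le> \<epsilon> * cmod z" using e mult_right_mono[of "2 * e" \<epsilon> "cmod z"] by (simp add: mult_ac)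
    finally show "cmod (z - recip_cauchy M z) \<le> \<epsilon> * cmod z" .
    have "G w - G z = (z - w) * L"
      using cauchy_transform_diff[OF Im(2,1)] unfolding G_def L_def by (simp only: mult.commute)
    then have "(G w - G z) / (G z * G w) = (z - w) * L / (G z * G w)" by simp
    also have "(G w - G z) / (G z * G w) = recip_cauchy M z - recip_cauchy M w"
      using G unfolding recip_cauchy_def G_def[symmetric] by (simp add: field_simps)
    also have "(z - w) * L / (G z * G w) = (z - w) * l / (p * q)"
      using nz unfolding p_q_l_def by simp
    finally have "recip_cauchy M z - recip_cauchy M w = (z - w) * l / (p * q)" .
    moreover have "p * q \<noteq> 0" using half by auto
    ultimately have "(z - recip_cauchy M z) - (w - recip_cauchy M w) = (z - w) * (p * q - l) / (p * q)"
      by (simp add: field_simps)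
    then have "cmod ((z - recip_cauchy M z) - (w - recip_cauchy M w))
        = cmod (z - w) * cmod (p * q - l) / (cmod p * cmod q)"
      by (simp add: norm_mult norm_divide)
    also have "\<dots> \<le> cmod (z - w) * (4 * e) / (1 / 2 * (1 / 2))"
    proof (intro frac_le mult_left_mono mult_mono half)
      have "p * q - l = (p - 1) * q + (q - 1) - (l - 1)" by (simp add: algebra_simps)
      also have "cmod \<dots> \<le> cmod (p - 1) * cmod q + cmod (q - 1) + cmod (l - 1)"
        using norm_triangle_ineq4[of "(p - 1) * q + (q - 1)" "l - 1"]
          norm_triangle_ineq[of "(p - 1) * q" "q - 1"] unfolding norm_mult by linarith
      also have "\<dots> \<le> e * (3 / 2) + e + e" using pq half e by (intro add_mono mult_mono) auto
      finally show "cmod (p * q - l) \<le> 4 * e" using e by simp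
    qed (use e in auto)
    also have "\<dots> \<le> \<epsilon> * cmod (z - w)"
      using mult_right_mono[OF e(3), of "cmod (z - w)"] by (simp add: mult_ac)
    finally show "cmod ((z - recip_cauchy M z) - (w - recip_cauchy M w)) \<le> \<epsilon> * cmod (z - w)" .
  qed
qed

text \<open>The solution is the fixed point of w -> z - c (w - F w) on a ball about z with radius
  proportional to |z|. The sign of c is free: c = -1 turns the equation into F w = z and yields
  right inverses of F, while c > 0 gives the subordination equation.\<close>

lemma perturbed_identity_solvable:
  fixes c :: real
  assumes \<alpha>: "\<alpha> > 0" and r0: "r > 0" and \<beta>0: "\<beta>\<^sub>0 > 0"
  shows "\<exists>\<beta>>0. \<forall>z\<in>truncated_cone \<alpha> \<beta>. \<exists>w\<in>truncated_cone (2 * \<alpha> + 1) \<beta>\<^sub>0.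
     cmod (w - z) \<le> r * cmod z \<and> w + of_real c * (w - recip_cauchy M w) = z"
proof -
  \<comment> \<open>The cap on the radius keeps the ball inside the cone of aperture
    \<open>2 * \<alpha> + 1\<close>.\<close>
  define r' where "r' = min r (1 / (2 * (1 + \<alpha>)))"
  have r': "r' > 0" "r' \<le> r" "r' * (1 + \<alpha>) \<le> 1 / 2" "r' \<le> 1 / 2"
  proof -
    show "r' > 0" "r' \<le> r" using \<alpha> r0 by (auto simp: r'_def)
    have "r' \<le> 1 / (2 * (1 + \<alpha>))" by (simp add: r'_def)
    then show "r' * (1 + \<alpha>) \<le> 1 / 2" using \<alpha> by (simp add: field_simps)
    moreover have "r' * 1 \<le> r' * (1 + \<alpha>)" using \<alpha> \<open>r' > 0\<close> by (intro mult_left_mono) auto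
    ultimately show "r' \<le> 1 / 2" by simp
  qed
  \<comment> \<open>Makes |c| \<epsilon> at most r' / 2. As |w| is at most 2 |z| on the ball,
    \<open>T\<close> then stays within r' |z| of z, and its Lipschitz constant is at most 1/2. The
    \<open>+ 1\<close> covers c = 0.\<close>
  define \<epsilon> where "\<epsilon> = r' / (2 * (\<bar>c\<bar> + 1))"
  have "\<bar>c\<bar> * \<epsilon> \<le> (\<bar>c\<bar> + 1) * \<epsilon>" using r' by (intro mult_right_mono) (auto simp: \<epsilon>_def)
  also have "\<dots> = r' / 2" by (simp add: \<epsilon>_def field_simps)
  finally have c\<epsilon>: "\<bar>c\<bar> * \<epsilon> \<le> r' / 2" .
  have \<epsilon>: "\<epsilon> > 0" using r' by (simp add: \<epsilon>_def)
  obtain \<beta>1 where \<beta>1: "\<beta>1 > 0" and h: "\<And>z w. z \<in> truncated_cone (2 * \<alpha> + 1) \<beta>1 \<Longrightarrow> w \<in> truncated_cone (2 * \<alpha> + 1) \<beta>1 \<Longrightarrow>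
     cmod (z - recip_cauchy M z) \<le> \<epsilon> * cmod z \<and>
     cmod ((z - recip_cauchy M z) - (w - recip_cauchy M w)) \<le> \<epsilon> * cmod (z - w)"
    using recip_cauchy_nontangential[of "2 * \<alpha> + 1" \<epsilon>] \<alpha> \<epsilon> by auto
  \<comment> \<open>Doubled because points of the ball are only guaranteed half the height of
    z.\<close>
  define \<beta> where "\<beta> = 2 * max \<beta>1 \<beta>\<^sub>0"
  have \<beta>: "\<beta> > 0" using \<beta>1 by (auto simp: \<beta>_def)
  show ?thesis
  proof (intro exI[of _ \<beta>] conjI ballI \<beta>)
    fix z assume z: "z \<in> truncated_cone \<alpha> \<beta>"
    define B where "B = cball z (r' * cmod z)"
    define T where "T w = z - of_real c * (w - recip_cauchy M w)" for w
    have B: "w \<in> truncated_cone (2 * \<alpha> + 1) \<beta>1" "w \<in> truncated_cone (2 * \<alpha> + 1) \<beta>\<^sub>0" if "w \<in> B" for w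
    proof -
      have "w \<in> truncated_cone (2 * \<alpha> + 1) (\<beta> / 2)"
        using that \<alpha> \<beta> r' z by (intro truncated_cone_neighbour[of z \<alpha> \<beta> r'])
          (auto simp: B_def dist_norm norm_minus_commute)
      then show "w \<in> truncated_cone (2 * \<alpha> + 1) \<beta>1" "w \<in> truncated_cone (2 * \<alpha> + 1) \<beta>\<^sub>0"
        by (auto simp: truncated_cone_iff \<beta>_def)
    qed
    have "\<exists>!w\<in>B. T w = w"
    proof (rule Banach_fix)
      show "uniform_space_class.complete B" "B \<noteq> {}" unfolding B_def using mult_nonneg_nonneg[of r' "cmod z"] r'(1) by (auto simp: complete_eq_closed not_less)
      show "0 \<le> 1 / (2 :: real)" "1 / 2 < (1 :: real)" by auto
      show "T ` B \<subseteq> B"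
      proof clarify
        fix w assume w: "w \<in> B"
        have "cmod w \<le> cmod z + r' * cmod z"
          using w norm_triangle_ineq[of z "w - z"] by (simp add: B_def dist_norm norm_minus_commute)
        also have "\<dots> \<le> 2 * cmod z" using r' mult_right_mono[OF r'(4), of "cmod z"] norm_ge_zero[of z]
          by linarith
        finally have w2: "cmod w \<le> 2 * cmod z" .
        have "cmod (z - T w) = \<bar>c\<bar> * cmod (w - recip_cauchy M w)" by (simp add: T_def norm_mult)
        also have "\<dots> \<le> \<bar>c\<bar> * (\<epsilon> * cmod w)" using h[OF B(1)[OF w] B(1)[OF w]] by (intro mult_left_mono) auto
        also have "\<dots> \<le> \<bar>c\<bar> * (\<epsilon> * (2 * cmod z))"
          using w2 \<epsilon> by (intro mult_left_mono) auto
        also have "\<dots> = \<bar>c\<bar> * \<epsilon> * (2 * cmod z)" by simp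
        also have "\<dots> \<le> r' / 2 * (2 * cmod z)" using c\<epsilon> by (intro mult_right_mono) auto
        finally show "T w \<in> B" by (simp add: B_def dist_norm)
      qed
      show "dist (T x) (T y) \<le> 1 / 2 * dist x y" if "x \<in> B" "y \<in> B" for x y
      proof -
        have "T x - T y = - of_real c * ((x - recip_cauchy M x) - (y - recip_cauchy M y))"
          by (simp add: T_def algebra_simps)
        then have "dist (T x) (T y) = \<bar>c\<bar> * cmod ((x - recip_cauchy M x) - (y - recip_cauchy M y))"
          by (simp add: dist_norm norm_mult)
        also have "\<dots> \<le> \<bar>c\<bar> * (\<epsilon> * cmod (x - y))"
          using h[OF B(1)[OF that(1)] B(1)[OF that(2)]] by (intro mult_left_mono) auto
        also have "\<dots> \<le> r' / 2 * cmod (x - y)"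
          using c\<epsilon> unfolding mult.assoc[symmetric] by (intro mult_right_mono) auto
        also have "\<dots> \<le> 1 / 2 * dist x y" using r' unfolding dist_norm by (intro mult_right_mono) auto
        finally show ?thesis .
      qed
    qed
    then obtain w where w: "w \<in> B" "T w = w" by auto
    have "cmod (w - z) \<le> r' * cmod z" using w by (simp add: B_def dist_norm norm_minus_commute)
    also have "\<dots> \<le> r * cmod z" using r' by (intro mult_right_mono) auto
    finally have "cmod (w - z) \<le> r * cmod z" .
    moreover have "w + of_real c * (w - recip_cauchy M w) = z" using w(2) by (simp add: T_def algebra_simps)
    ultimately show "\<exists>w\<in>truncated_cone (2 * \<alpha> + 1) \<beta>\<^sub>0.
        cmod (w - z) \<le> r * cmod z \<and> w + of_real c * (w - recip_cauchy M w) = z"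
      using B(2)[OF w(1)] by blast
  qed
qed

end

section \<open>Subordination functions\<close>

context real_distribution
begin

lemma Im_perturbed_identity:
  "Im (w + of_real c * (w - recip_cauchy M w)) = (1 + c) * Im w - c * Im (recip_cauchy M w)"
  by (simp add: algebra_simps)

lemma perturbed_identity_Im_le:
  assumes "c > 0" "Im w > 0"
  shows "Im (w + of_real c * (w - recip_cauchy M w)) \<le> Im w"
  using mult_left_mono[OF Im_recip_cauchy_ge[OF assms(2)], of c] assms(1)
  unfolding Im_perturbed_identity by (simp add: algebra_simps)

text \<open>If two points had the same image, F would stretch their distance by exactly (1 + c) / c.
  Positivity of the imaginary part of the image says that Im F < ((1 + c) / c) Im at both points,
  and then Schwarz-Pick permits only a strictly smaller factor.\<close>

lemma perturbed_identity_inj: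
  assumes c: "c > 0" and w: "Im w > 0" and w': "Im w' > 0"
    and pos: "Im (w + of_real c * (w - recip_cauchy M w)) > 0"
    and eq: "w + of_real c * (w - recip_cauchy M w) = w' + of_real c * (w' - recip_cauchy M w')"
  shows "w = w'"
proof (rule ccontr)
  assume "w \<noteq> w'"
  define A A' where "A = Im (recip_cauchy M w)" and "A' = Im (recip_cauchy M w')"
  have A: "A > 0" "A' > 0"
    using Im_recip_cauchy_ge[OF w] Im_recip_cauchy_ge[OF w'] w w' by (auto simp: A_def A'_def)
  have lt: "c * A < (1 + c) * Im w" "c * A' < (1 + c) * Im w'"
    using pos pos[unfolded eq] unfolding Im_perturbed_identity by (auto simp: A_def A'_def)
  have "of_real (1 + c) * (w - w') = of_real c * (recip_cauchy M w - recip_cauchy M w')"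
    using eq by (simp add: algebra_simps)
  then have "cmod (of_real (1 + c) * (w - w')) = cmod (of_real c * (recip_cauchy M w - recip_cauchy M w'))"
    by (rule arg_cong)
  then have "(1 + c) * cmod (w - w') = c * cmod (recip_cauchy M w - recip_cauchy M w')"
    using c unfolding norm_mult norm_of_real by simp
  then have "((1 + c) * cmod (w - w'))\<^sup>2 = (c * cmod (recip_cauchy M w - recip_cauchy M w'))\<^sup>2"
    by (rule arg_cong)
  then have "(cmod (w - w'))\<^sup>2 * (((1 + c) * Im w) * ((1 + c) * Im w'))
      = c\<^sup>2 * ((cmod (recip_cauchy M w - recip_cauchy M w'))\<^sup>2 * (Im w * Im w'))"
    by (simp only: power_mult_distrib power2_eq_square mult_ac)
  also have "\<dots> \<le> c\<^sup>2 * ((cmod (w - w'))\<^sup>2 * (A * A'))"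
    unfolding A_def A'_def by (intro mult_left_mono recip_cauchy_schwarz_pick w w') auto
  also have "\<dots> = (cmod (w - w'))\<^sup>2 * ((c * A) * (c * A'))"
    by (simp add: power2_eq_square)
  also have "\<dots> < (cmod (w - w'))\<^sup>2 * (((1 + c) * Im w) * ((1 + c) * Im w'))"
    using \<open>w \<noteq> w'\<close> A c w w' by (intro mult_strict_left_mono mult_strict_mono[OF lt]) auto
  finally show False by simp
qed

text \<open>Here the normalisation of the reciprocal Cauchy transform at infinity enters: if \<open>w\<close> were much
  larger than its image, then \<open>recip_cauchy M w\<close> would be close to \<open>(1 + 1 / c) * w\<close>, which
  contradicts the Schwarz-Pick inequality between \<open>w\<close> and a point high up on the imaginary axis.\<close>
lemma perturbed_identity_proper:
  assumes c: "c > 0"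
  obtains K1 K2 where "\<And>w. Im w > 0 \<Longrightarrow> Im (w + of_real c * (w - recip_cauchy M w)) > 0 \<Longrightarrow>
      cmod w \<le> K1 + K2 * cmod (w + of_real c * (w - recip_cauchy M w))"
proof -
  \<comment> \<open>\<kappa> is the ratio F w / w that would hold if the image of w were 0, and q is
    the midpoint between 1 and \<kappa>. The base point \<open>w0\<close> is taken so high that Im
    (F w0) / Im w0 is at most q.\<close>
  define \<kappa> q where "\<kappa> = 1 + 1 / c" and "q = 1 + 1 / (2 * c)"
  have \<kappa>: "0 < q" "q < \<kappa>" "\<kappa> > 0" "c * \<kappa> = 1 + c" using c by (auto simp: \<kappa>_def q_def field_simps)
  obtain \<beta> where \<beta>: "\<beta> > 0"
    and h: "\<And>z. z \<in> truncated_cone 1 \<beta> \<Longrightarrow> cmod (z - recip_cauchy M z) \<le> 1 / (2 * c) * cmod z"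
    using recip_cauchy_nontangential[of 1 "1 / (2 * c)"] c by auto
  define w0 where "w0 = Complex 0 (\<beta> + 1)"
  have Im0: "Im w0 > 0" "cmod w0 = Im w0" using \<beta> by (auto simp: w0_def cmod_def)
  have "cmod (w0 - recip_cauchy M w0) \<le> 1 / (2 * c) * Im w0"
    using h[of w0] \<beta> Im0 by (simp add: w0_def truncated_cone_iff)
  then have q: "Im (recip_cauchy M w0) \<le> q * Im w0"
    using abs_Im_le_cmod[of "w0 - recip_cauchy M w0"] by (simp add: q_def algebra_simps)
  \<comment> \<open>The Lipschitz constant that Schwarz-Pick gives between w and \<open>w0\<close>:
    the geometric mean of the two bounds on Im F / Im. Since it is below \<kappa>, its term can be
    absorbed on the left at the end.\<close>
  define \<sigma> where "\<sigma> = sqrt (\<kappa> * q)"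
  have "\<kappa> * q < \<kappa> * \<kappa>" using \<kappa> by (intro mult_strict_left_mono)
  then have "\<sigma> < sqrt (\<kappa> * \<kappa>)" unfolding \<sigma>_def by (rule real_sqrt_less_mono)
  then have \<sigma>: "\<sigma> < \<kappa>" using \<kappa> by simp
  have \<sigma>0: "\<sigma> \<ge> 0" "\<sigma>\<^sup>2 = \<kappa> * q" using \<kappa> by (auto simp: \<sigma>_def)
  define N where "N = \<kappa> * cmod w0 + cmod (recip_cauchy M w0)"
  show ?thesis
  proof (rule that[of "cmod w0 + N / (\<kappa> - \<sigma>)" "1 / c / (\<kappa> - \<sigma>)"])
    fix w assume w: "Im w > 0" and pos: "Im (w + of_real c * (w - recip_cauchy M w)) > 0"
    define z where "z = w + of_real c * (w - recip_cauchy M w)"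
    have "c * Im (recip_cauchy M w) \<le> c * (\<kappa> * Im w)"
      using pos \<kappa> unfolding Im_perturbed_identity mult.assoc[symmetric] by simp
    then have I: "Im (recip_cauchy M w) \<le> \<kappa> * Im w" using c by simp
    have "(cmod (recip_cauchy M w - recip_cauchy M w0))\<^sup>2 * (Im w * Im w0)
       \<le> (cmod (w - w0))\<^sup>2 * (Im (recip_cauchy M w) * Im (recip_cauchy M w0))"
      by (rule recip_cauchy_schwarz_pick[OF w Im0(1)])
    also have "\<dots> \<le> (cmod (w - w0))\<^sup>2 * ((\<kappa> * Im w) * (q * Im w0))"
      using I q w Im0 \<kappa> Im_recip_cauchy_ge[OF w] Im_recip_cauchy_ge[OF Im0(1)]
      by (intro mult_left_mono mult_mono) auto
    also have "\<dots> = (\<sigma> * cmod (w - w0))\<^sup>2 * (Im w * Im w0)"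
      using \<sigma>0 by (simp add: power_mult_distrib mult_ac)
    finally have "(cmod (recip_cauchy M w - recip_cauchy M w0))\<^sup>2 \<le> (\<sigma> * cmod (w - w0))\<^sup>2"
      by (rule mult_right_le_imp_le) (intro mult_pos_pos w Im0(1))
    then have le: "cmod (recip_cauchy M w - recip_cauchy M w0) \<le> \<sigma> * cmod (w - w0)"
      by (rule power2_le_imp_le) (simp add: \<sigma>0(1))
    \<comment> \<open>The definition of z rewritten as F w = \<kappa> w - z / c, with
      \<open>w0\<close> and F w0 inserted.\<close>
    have "of_real \<kappa> * (w - w0) = (recip_cauchy M w - recip_cauchy M w0)
        + (of_real (1 / c) * z - of_real \<kappa> * w0 + recip_cauchy M w0)"
      using c by (simp add: z_def \<kappa>_def field_simps)
    then have "\<kappa> * cmod (w - w0) = cmod ((recip_cauchy M w - recip_cauchy M w0)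
        + (of_real (1 / c) * z - of_real \<kappa> * w0 + recip_cauchy M w0))"
      using \<kappa> norm_mult[of "of_real \<kappa>" "w - w0"] by simp
    also have "\<dots> \<le> cmod (recip_cauchy M w - recip_cauchy M w0)
        + ((cmod (of_real (1 / c) * z) + cmod (of_real \<kappa> * w0)) + cmod (recip_cauchy M w0))"
      by (intro norm_triangle_mono order_refl norm_triangle_ineq4)
    also have "\<dots> \<le> \<sigma> * cmod (w - w0) + (1 / c * cmod z + N)"
      using le c \<kappa> unfolding norm_mult norm_of_real N_def by simp
    finally have "(\<kappa> - \<sigma>) * cmod (w - w0) \<le> 1 / c * cmod z + N" by (simp add: algebra_simps)
    then have "cmod (w - w0) \<le> (1 / c * cmod z + N) / (\<kappa> - \<sigma>)"
      using \<sigma> by (simp add: pos_le_divide_eq mult.commute)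
    moreover have "cmod w \<le> cmod w0 + cmod (w - w0)"
      using norm_triangle_ineq[of w0 "w - w0"] by simp
    ultimately show "cmod w \<le> cmod w0 + N / (\<kappa> - \<sigma>) + 1 / c / (\<kappa> - \<sigma>) * cmod (w + of_real c * (w - recip_cauchy M w))"
      unfolding z_def[symmetric] by (simp add: add_divide_distrib)
  qed
qed

text \<open>The fourth property, that \<omega> undoes H wherever H stays in the half-plane, allows
  any solution found by contraction to be recognised as \<omega> z. The asymptotics in cones are
  obtained in this way.\<close>

lemma subordination_function_exists:
  fixes c :: real
  assumes c: "c > 0"
  obtains \<omega> where "\<omega> holomorphic_on upper_half_plane"
    "\<And>z. Im z > 0 \<Longrightarrow> Im (\<omega> z) \<ge> Im z"
    "\<And>z. Im z > 0 \<Longrightarrow> \<omega> z + of_real c * (\<omega> z - recip_cauchy M (\<omega> z)) = z"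
    "\<And>w. Im w > 0 \<Longrightarrow> Im (w + of_real c * (w - recip_cauchy M w)) > 0 \<Longrightarrow>
       \<omega> (w + of_real c * (w - recip_cauchy M w)) = w"
    "\<And>\<alpha> r. \<alpha> > 0 \<Longrightarrow> r > 0 \<Longrightarrow> \<exists>\<beta>>0. \<forall>z\<in>truncated_cone \<alpha> \<beta>. cmod (\<omega> z - z) \<le> r * cmod z"
proof -
  define H where "H w = w + of_real c * (w - recip_cauchy M w)" for w
  define \<Omega> where "\<Omega> = upper_half_plane \<inter> H -` upper_half_plane"
  have holH: "H holomorphic_on upper_half_plane"
    unfolding H_def by (intro holomorphic_intros holomorphic_recip_cauchy)
  then have contH: "continuous_on upper_half_plane H" by (rule holomorphic_on_imp_continuous_on)
  have op: "open \<Omega>"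
    unfolding \<Omega>_def by (rule continuous_open_preimage[OF contH open_upper_half_plane open_upper_half_plane])
  have hol\<Omega>: "H holomorphic_on \<Omega>" using holH by (rule holomorphic_on_subset) (auto simp: \<Omega>_def)
  have inj: "inj_on H \<Omega>"
    using perturbed_identity_inj[OF c] by (auto simp: inj_on_def \<Omega>_def upper_half_plane_iff H_def)
  have "H ` \<Omega> = upper_half_plane"
  proof -
    have "openin (top_of_set upper_half_plane) (H ` \<Omega>)"
      using open_mapping_thm3[OF hol\<Omega> op inj] open_upper_half_plane
      by (auto simp: openin_open_eq \<Omega>_def)
    moreover have "closedin (top_of_set upper_half_plane) (H ` \<Omega>)"
      unfolding closedin_limpt
    proof (intro conjI allI impI)
      fix z assume z: "z islimpt H ` \<Omega> \<and> z \<in> upper_half_plane"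
      then obtain f where f: "\<And>n::nat. f n \<in> H ` \<Omega>" "f \<longlonglongrightarrow> z"
        unfolding islimpt_sequential by blast
      then have "\<forall>n. \<exists>w. w \<in> \<Omega> \<and> f n = H w" by blast
      then obtain g where g: "\<And>n. g n \<in> \<Omega>" "\<And>n. f n = H (g n)" by metis
      obtain B where B: "\<And>n. cmod (f n) \<le> B"
        using convergent_imp_bounded[OF f(2)] by (auto simp: bounded_iff)
      obtain K1 K2 where K: "\<And>w. Im w > 0 \<Longrightarrow> Im (H w) > 0 \<Longrightarrow> cmod w \<le> K1 + K2 * cmod (H w)"
        using perturbed_identity_proper[OF c] unfolding H_def by blast
      have gpos: "Im (g n) > 0" "Im (H (g n)) > 0" for n
        using g(1)[of n] by (auto simp: \<Omega>_def upper_half_plane_iff)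
      have "cmod (g n) \<le> K1 + \<bar>K2\<bar> * B" for n
      proof -
        have "cmod (g n) \<le> K1 + K2 * cmod (f n)" using K[OF gpos] g(2) by simp
        also have "\<dots> \<le> K1 + \<bar>K2\<bar> * B"
          using B[of n] by (intro add_left_mono mult_mono) auto
        finally show ?thesis .
      qed
      then have "bounded (range g)" by (auto simp: bounded_iff)
      then obtain w r where r: "strict_mono r" "(g \<circ> r) \<longlonglongrightarrow> w"
        using bounded_imp_convergent_subsequence by blast
      have fr: "(\<lambda>n. f (r n)) \<longlonglongrightarrow> z" using LIMSEQ_subseq_LIMSEQ[OF f(2) r(1)] by (simp add: comp_def)
      \<comment> \<open>Properness rules out escape to infinity; escape to the real axis is
        impossible because H does not increase imaginary parts.\<close>
      have "Im z \<le> Im w"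
      proof (rule LIMSEQ_le[OF tendsto_Im[OF fr] tendsto_Im[OF r(2)]])
        show "\<exists>N. \<forall>n\<ge>N. Im (f (r n)) \<le> Im ((g \<circ> r) n)"
          using perturbed_identity_Im_le[OF c gpos(1)] by (auto simp: g(2) H_def)
      qed
      then have w: "Im w > 0" using z by (simp add: upper_half_plane_iff)
      then have "isCont H w"
        using contH open_upper_half_plane by (simp add: continuous_on_eq_continuous_at upper_half_plane_iff)
      then have "(\<lambda>n. H ((g \<circ> r) n)) \<longlonglongrightarrow> H w" using r(2) by (rule isCont_tendsto_compose)
      then have "(\<lambda>n. f (r n)) \<longlonglongrightarrow> H w" by (simp add: g(2))
      then have "H w = z" using fr by (rule LIMSEQ_unique)
      then show "z \<in> H ` \<Omega>" using w z by (auto simp: \<Omega>_def upper_half_plane_iff)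
    qed (auto simp: \<Omega>_def)
    moreover have "H ` \<Omega> \<noteq> {}"
    proof -
      obtain \<beta> where \<beta>: "\<beta> > 0" "\<And>z. z \<in> truncated_cone 1 \<beta> \<Longrightarrow>
          \<exists>w\<in>truncated_cone (2 * 1 + 1) 1. cmod (w - z) \<le> 1 * cmod z \<and> H w = z"
        using perturbed_identity_solvable[of 1 1 1 c] unfolding H_def by auto
      have "Complex 0 (\<beta> + 1) \<in> truncated_cone 1 \<beta>" using \<beta> by (simp add: truncated_cone_iff)
      from \<beta>(2)[OF this] obtain w where "w \<in> truncated_cone 3 1" "H w = Complex 0 (\<beta> + 1)" by auto
      then have "w \<in> \<Omega>" using \<beta> by (auto simp: \<Omega>_def upper_half_plane_iff truncated_cone_iff)
      then show ?thesis by blast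
    qed
    ultimately show ?thesis
      using convex_connected[OF convex_upper_half_plane] unfolding connected_clopen by blast
  qed
  moreover obtain \<omega> where \<omega>: "\<omega> holomorphic_on H ` \<Omega>" "\<And>w. w \<in> \<Omega> \<Longrightarrow> \<omega> (H w) = w"
    using holomorphic_has_inverse[OF hol\<Omega> op inj] by metis
  ultimately have im: "H ` \<Omega> = upper_half_plane" and hol: "\<omega> holomorphic_on upper_half_plane" by auto
  have in\<Omega>: "\<omega> z \<in> \<Omega>" "H (\<omega> z) = z" if "Im z > 0" for z
  proof -
    have "z \<in> H ` \<Omega>" using that im by (simp add: upper_half_plane_iff)
    then show "\<omega> z \<in> \<Omega>" "H (\<omega> z) = z" using \<omega>(2) by auto
  qed
  have left: "\<omega> (H w) = w" if "Im w > 0" "Im (H w) > 0" for w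
    using that \<omega>(2) by (auto simp: \<Omega>_def upper_half_plane_iff)
  show ?thesis
  proof (rule that[OF hol])
    fix z assume z: "Im z > 0"
    have "Im (\<omega> z) > 0" using in\<Omega>(1)[OF z] by (simp add: \<Omega>_def upper_half_plane_iff)
    from perturbed_identity_Im_le[OF c this, folded H_def] show "Im z \<le> Im (\<omega> z)"
      by (simp add: in\<Omega>(2)[OF z])
    show "\<omega> z + of_real c * (\<omega> z - recip_cauchy M (\<omega> z)) = z"
      using in\<Omega>(2)[OF z] by (simp add: H_def)
  next
    fix w assume "Im w > 0" "Im (w + of_real c * (w - recip_cauchy M w)) > 0"
    then show "\<omega> (w + of_real c * (w - recip_cauchy M w)) = w" using left by (simp add: H_def)
  next
    fix \<alpha> r :: real assume "\<alpha> > 0" "r > 0"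
    then obtain \<beta> where \<beta>: "\<beta> > 0" "\<And>z. z \<in> truncated_cone \<alpha> \<beta> \<Longrightarrow>
        \<exists>w\<in>truncated_cone (2 * \<alpha> + 1) 1. cmod (w - z) \<le> r * cmod z \<and> H w = z"
      using perturbed_identity_solvable[of \<alpha> r 1 c] unfolding H_def by auto
    have "cmod (\<omega> z - z) \<le> r * cmod z" if z: "z \<in> truncated_cone \<alpha> \<beta>" for z
    proof -
      obtain w where w: "w \<in> truncated_cone (2 * \<alpha> + 1) 1" "cmod (w - z) \<le> r * cmod z" "H w = z"
        using \<beta>(2)[OF z] by auto
      then have "\<omega> z = w" using left[of w] z by (simp add: truncated_cone_iff)
      with w show ?thesis by simp
    qed
    then show "\<exists>\<beta>>0. \<forall>z\<in>truncated_cone \<alpha> \<beta>. cmod (\<omega> z - z) \<le> r * cmod z" using \<beta>(1) by blast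
  qed
qed

end

section \<open>Stieltjes inversion\<close>

lemma arctan_kernel_derivative:
  fixes x y s :: real
  assumes "y > 0"
  shows "((\<lambda>x. arctan ((x - s) / y)) has_real_derivative y * (cmod (1 / (Complex x y - complex_of_real s)))\<^sup>2) (at x)"
proof -
  have [simp]: "y \<noteq> 0" using assms by simp
  have nz: "y\<^sup>2 + (x - s)\<^sup>2 \<noteq> 0" using assms by (simp add: sum_power2_eq_zero_iff)
  have "((\<lambda>x. arctan ((x - s) / y)) has_real_derivative inverse (1 + ((x - s) / y)\<^sup>2) * (1 / y)) (at x)"
    by (auto intro!: derivative_eq_intros)
  also have "inverse (1 + ((x - s) / y)\<^sup>2) * (1 / y) = y * (1 / ((x - s)\<^sup>2 + y\<^sup>2))"
    using assms nz by (simp add: divide_simps) (simp add: power2_eq_square algebra_simps)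
  also have "1 / ((x - s)\<^sup>2 + y\<^sup>2) = (cmod (1 / (Complex x y - complex_of_real s)))\<^sup>2"
    by (simp add: norm_divide power_divide cmod_power2)
  finally show ?thesis .
qed

context real_distribution
begin

text \<open>On the line at height y, minus the imaginary part of the Cauchy transform is the Poisson
  kernel integrated against M. The kernel is nonnegative, so Tonelli applies, and its antiderivative
  in x is an arctangent.\<close>

lemma stieltjes_fubini:
  assumes y: "y > 0" and ab: "a \<le> b"
  shows "(\<integral>\<^sup>+x. ennreal (- Im (cauchy_transform M (Complex x y))) * indicator {a..b} x \<partial>lborel)
       = ennreal (LINT s|M. arctan ((b - s) / y) - arctan ((a - s) / y))"
proof -
  define k where "k x s = y * (cmod (1 / (Complex x y - complex_of_real s)))\<^sup>2" for x s
  have k0: "k x s \<ge> 0" for x s using y by (simp add: k_def)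
  have kc: "continuous_on UNIV (\<lambda>(x, s). k x s)"
  proof -
    have "Complex x y - complex_of_real s \<noteq> 0" for x s
      using y minus_real_nonzero[of "Complex x y" s] by simp
    then show ?thesis
      unfolding k_def case_prod_beta Complex_eq by (intro continuous_intros) (auto simp: Complex_eq)
  qed
  have [measurable]: "(\<lambda>(x, s). k x s) \<in> borel_measurable (borel \<Otimes>\<^sub>M borel)"
    using borel_measurable_continuous_onI[OF kc] by (simp add: borel_prod)
  have eq: "ennreal (- Im (cauchy_transform M (Complex x y))) = (\<integral>\<^sup>+s. ennreal (k x s) \<partial>M)" for x
  proof -
    have "(\<integral>\<^sup>+s. ennreal (k x s) \<partial>M) = ennreal (LINT s|M. k x s)"
      unfolding k_def using y
      by (intro nn_integral_eq_integral integrable_mult_right integrable_cauchy_kernel_sq) auto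
    then show ?thesis using y by (simp add: Im_cauchy_transform k_def)
  qed
  interpret P: pair_sigma_finite lborel M
    by unfold_locales
  have meas: "(\<lambda>(x, s). ennreal (k x s) * indicator {a..b} x) \<in> borel_measurable (lborel \<Otimes>\<^sub>M M)"
  proof -
    have "sets (lborel \<Otimes>\<^sub>M M) = sets (borel \<Otimes>\<^sub>M borel)"
      by (intro sets_pair_measure_cong) simp_all
    note eq = measurable_cong_sets[OF this refl]
    show ?thesis unfolding eq by measurable
  qed
  have "(\<integral>\<^sup>+x. ennreal (- Im (cauchy_transform M (Complex x y))) * indicator {a..b} x \<partial>lborel)
      = (\<integral>\<^sup>+x. (\<integral>\<^sup>+s. ennreal (k x s) * indicator {a..b} x \<partial>M) \<partial>lborel)"
    unfolding eq by (intro nn_integral_cong nn_integral_multc[symmetric]) measurable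
  also have "\<dots> = (\<integral>\<^sup>+s. (\<integral>\<^sup>+x. ennreal (k x s) * indicator {a..b} x \<partial>lborel) \<partial>M)"
    using P.Fubini'[OF meas] by simp
  also have "\<dots> = (\<integral>\<^sup>+s. ennreal (arctan ((b - s) / y) - arctan ((a - s) / y)) \<partial>M)"
  proof (rule nn_integral_cong)
    fix s
    have [measurable]: "(\<lambda>x. k x s) \<in> borel_measurable borel" by measurable
    show "(\<integral>\<^sup>+x. ennreal (k x s) * indicator {a..b} x \<partial>lborel)
        = ennreal (arctan ((b - s) / y) - arctan ((a - s) / y))"
    proof (intro nn_integral_FTC_Icc k0 ab)
      show "((\<lambda>x. arctan ((x - s) / y)) has_real_derivative k x s) (at x)" for x
        unfolding k_def by (rule arctan_kernel_derivative[OF y])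
    qed measurable
  qed
  also have "\<dots> = ennreal (LINT s|M. arctan ((b - s) / y) - arctan ((a - s) / y))"
  proof (rule nn_integral_eq_integral)
    show "integrable M (\<lambda>s. arctan ((b - s) / y) - arctan ((a - s) / y))"
    proof (rule integrable_bounded[where B="pi"])
      show "norm (arctan ((b - s) / y) - arctan ((a - s) / y)) \<le> pi" for s
        using arctan_bounded[of "(b - s) / y"] arctan_bounded[of "(a - s) / y"] by auto
    qed auto
    show "AE s in M. 0 \<le> arctan ((b - s) / y) - arctan ((a - s) / y)"
      using ab y by (auto simp: arctan_le_iff divide_right_mono)
  qed
  finally show ?thesis .
qed

text \<open>The height 1 / (n + 1) tends to 0 while the left endpoint -(n + 1) tends to minus
  infinity, so one sequence covers the whole half-line. An atom at b contributes half its mass, as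
  arctan 0 = 0; hence the mean of the closed and the open half-line.\<close>

lemma integral_arctan_tendsto_cdf:
  "(\<lambda>n. LINT s|M. arctan ((b - s) * real (Suc n)) - arctan ((- real (Suc n) - s) * real (Suc n)))
     \<longlonglongrightarrow> pi / 2 * (cdf M b + measure M {..<b})"
proof -
  have inf: "filterlim (\<lambda>n. real (Suc n)) at_top sequentially"
    using filterlim_real_sequentially filterlim_Suc by (rule filterlim_compose)
  have lim1: "(\<lambda>n. arctan ((b - s) * real (Suc n))) \<longlonglongrightarrow> pi / 2 * sgn (b - s)" for s
  proof -
    consider "b > s" | "b = s" | "b < s" by linarith
    then show ?thesis
    proof cases
      case 1
      then have "filterlim (\<lambda>n. (b - s) * real (Suc n)) at_top sequentially"
        by (intro filterlim_tendsto_pos_mult_at_top[OF tendsto_const] inf) auto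
      from filterlim_compose[OF tendsto_arctan_at_top this] 1 show ?thesis by simp
    next
      case 3
      then have "filterlim (\<lambda>n. (b - s) * real (Suc n)) at_bot sequentially"
        by (intro filterlim_tendsto_neg_mult_at_bot[OF tendsto_const] inf) auto
      from filterlim_compose[OF tendsto_arctan_at_bot this] 3 show ?thesis by simp
    qed simp
  qed
  have lim2: "(\<lambda>n. arctan ((- real (Suc n) - s) * real (Suc n))) \<longlonglongrightarrow> - (pi / 2)" for s
  proof -
    have "filterlim (\<lambda>n. s + real (Suc n)) at_top sequentially"
      by (intro filterlim_tendsto_add_at_top[OF tendsto_const] inf)
    then have "filterlim (\<lambda>n. (s + real (Suc n)) * real (Suc n)) at_top sequentially"
      using inf by (rule filterlim_at_top_mult_at_top)
    then have "filterlim (\<lambda>n. - ((s + real (Suc n)) * real (Suc n))) at_bot sequentially"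
      by (simp add: filterlim_uminus_at_bot)
    also have "(\<lambda>n. - ((s + real (Suc n)) * real (Suc n))) = (\<lambda>n. (- real (Suc n) - s) * real (Suc n))"
      by (simp add: algebra_simps)
    finally show ?thesis by (rule filterlim_compose[OF tendsto_arctan_at_bot])
  qed
  have "(\<lambda>n. LINT s|M. arctan ((b - s) * real (Suc n)) - arctan ((- real (Suc n) - s) * real (Suc n)))
     \<longlonglongrightarrow> (LINT s|M. pi / 2 * sgn (b - s) - (- (pi / 2)))"
  proof (rule integral_dominated_convergence[where w="\<lambda>_. pi"])
    show "AE s in M. (\<lambda>n. arctan ((b - s) * real (Suc n)) - arctan ((- real (Suc n) - s) * real (Suc n)))
        \<longlonglongrightarrow> pi / 2 * sgn (b - s) - (- (pi / 2))"
      by (intro AE_I2 tendsto_diff lim1 lim2)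
    show "AE s in M. norm (arctan ((b - s) * real (Suc n)) - arctan ((- real (Suc n) - s) * real (Suc n))) \<le> pi" for n
    proof (rule AE_I2)
      fix s
      show "norm (arctan ((b - s) * real (Suc n)) - arctan ((- real (Suc n) - s) * real (Suc n))) \<le> pi"
        using arctan_bounded[of "(b - s) * real (Suc n)"] arctan_bounded[of "(- real (Suc n) - s) * real (Suc n)"]
        unfolding real_norm_def by linarith
    qed
  qed auto
  also have "(\<lambda>s. pi / 2 * sgn (b - s) - (- (pi / 2))) = (\<lambda>s. pi / 2 * (indicator {..b} s + indicator {..<b} s))"
    by (auto simp: fun_eq_iff indicator_def sgn_if)
  also have "(LINT s|M. pi / 2 * (indicator {..b} s + indicator {..<b} s)) = pi / 2 * (cdf M b + measure M {..<b})"
    by (simp add: cdf_def emeasure_eq_measure)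
  finally show ?thesis .
qed

end

lemma cauchy_transform_determines_distribution:
  assumes "real_distribution M" "real_distribution N"
    and eq: "\<And>z. Im z > 0 \<Longrightarrow> cauchy_transform M z = cauchy_transform N z"
  shows "M = N"
proof -
  interpret DM: real_distribution M by fact
  interpret DN: real_distribution N by fact
  have sum_eq: "cdf M b + measure M {..<b} = cdf N b + measure N {..<b}" for b
  proof -
    let ?A = "\<lambda>M n. LINT s|M. arctan ((b - s) * real (Suc n)) - arctan ((- real (Suc n) - s) * real (Suc n))"
    have "\<forall>\<^sub>F n in sequentially. ?A M n = ?A N n"
    proof -
      obtain n0 where n0: "- b \<le> real n0" using real_arch_simple by blast
      have "?A M n = ?A N n" if n: "n \<ge> n0" for n
      proof -
        define y where "y = 1 / real (Suc n)"
        have y: "y > 0" by (simp add: y_def)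
        have ab: "- real (Suc n) \<le> b" using n0 n by linarith
        have pos: "0 \<le> ?A L n" for L
          using ab by (intro Bochner_Integration.integral_nonneg) (auto simp: arctan_le_iff mult_right_mono)
        have "ennreal (?A M n) = ennreal (?A N n)"
          using DM.stieltjes_fubini[OF y ab] DN.stieltjes_fubini[OF y ab] eq y by (simp add: y_def)
        then show ?thesis using pos by simp
      qed
      then show ?thesis by (auto simp: eventually_sequentially)
    qed
    then have "?A N \<longlonglongrightarrow> pi / 2 * (cdf M b + measure M {..<b})"
      using DM.integral_arctan_tendsto_cdf[of b] by (simp add: tendsto_cong)
    from LIMSEQ_unique[OF this DN.integral_arctan_tendsto_cdf] show ?thesis by simp
  qed
  \<comment> \<open>Right continuity removes the half-counted atoms: slightly to the right of b both
    summands of P are still below cdf Q b, whereas both summands of Q are at least cdf Q b.\<close>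
  have not_less: "\<not> cdf P b < cdf Q b"
    if "real_distribution P" "real_distribution Q"
      and sum_eq: "\<And>b. cdf P b + measure P {..<b} = cdf Q b + measure Q {..<b}" for P Q b
  proof
    assume lt: "cdf P b < cdf Q b"
    interpret DP: real_distribution P by fact
    interpret DQ: real_distribution Q by fact
    have "(cdf P \<longlongrightarrow> cdf P b) (at_right b)"
      using DP.cdf_is_right_cont[of b] by (simp add: continuous_within)
    then have "\<forall>\<^sub>F x in at_right b. cdf P x < cdf Q b" using lt by (rule order_tendstoD)
    then have "\<forall>\<^sub>F x in at_right b. cdf P x < cdf Q b \<and> b < x"
      using eventually_at_right_less[of b] by eventually_elim auto
    then obtain x where x: "cdf P x < cdf Q b" "b < x"
      using eventually_happens[of _ "at_right b"] trivial_limit_at_right_real by blast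
    have "measure P {..<x} \<le> cdf P x" unfolding cdf_def by (intro DP.finite_measure_mono) auto
    moreover have "cdf Q b \<le> measure Q {..<x}" unfolding cdf_def using x by (intro DQ.finite_measure_mono) auto
    moreover have "cdf Q b \<le> cdf Q x" using x by (intro DQ.cdf_nondecreasing) auto
    ultimately show False using sum_eq[of x] x by linarith
  qed
  have "cdf M b = cdf N b" for b
    using not_less[OF assms(1,2) sum_eq, of b] not_less[OF assms(2,1) sum_eq[symmetric], of b] by linarith
  then show ?thesis by (intro cdf_unique assms) auto
qed

section \<open>Poisson representation in the half-plane\<close>

text \<open>As |z - t|^2 = (t - z) (t - cnj z) for real t, the integrand is the boundary value of (g
  w - g z) / ((w - z) (w - cnj z)). Subtracting g z makes the singularity at z removable and cnj z
  lies in the lower half-plane, so Cauchy's theorem on a half-disc leaves only the arc, where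
  bounded g gives O(1 / R).\<close>

lemma half_plane_cauchy_difference:
  fixes g :: "complex \<Rightarrow> complex"
  assumes hol: "g holomorphic_on {w. Im w > - d}" and d: "d > 0"
    and bound: "\<And>w. Im w \<ge> 0 \<Longrightarrow> cmod (g w) \<le> B"
    and z: "Im z > 0"
  shows "((\<lambda>R. integral {-R..R} (\<lambda>t. (g (of_real t) - g z) * of_real ((cmod (1 / (z - of_real t)))\<^sup>2)))
           \<longlongrightarrow> 0) at_top"
proof -
  \<comment> \<open>The cut at height - Im z keeps cnj z outside the domain.\<close>
  define S where "S = {w. Im w > - min d (Im z)}"
  have S: "open S" "convex S" unfolding S_def by (rule open_halfspace_Im_gt, rule convex_halfspace_Im_gt)
  have holS: "g holomorphic_on S" using hol by (rule holomorphic_on_subset) (auto simp: S_def)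
  have nz: "w - cnj z \<noteq> 0" if "w \<in> S" for w
  proof
    assume "w - cnj z = 0"
    then have "Im w = - Im z" by (simp add: complex_eq_iff)
    then show False using that by (simp add: S_def)
  qed
  define p where "p w = (if w = z then deriv g z else (g w - g z) / (w - z))" for w
  define Q where "Q w = p w / (w - cnj z)" for w
  have "p holomorphic_on S" unfolding p_def by (rule pole_lemma_open[OF holS S(1)])
  then have holQ: "Q holomorphic_on S" unfolding Q_def using nz by (intro holomorphic_intros) auto
  have B: "B \<ge> 0" using order_trans[OF norm_ge_zero bound[of 0]] by simp
  have Qreal: "Q (of_real t) = (g (of_real t) - g z) * of_real ((cmod (1 / (z - of_real t)))\<^sup>2)" for t
  proof -
    have "complex_of_real ((cmod (1 / (z - of_real t)))\<^sup>2) = 1 / (z - of_real t) * cnj (1 / (z - of_real t))"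
      by (rule complex_norm_square)
    also have "\<dots> = 1 / ((of_real t - z) * (of_real t - cnj z))"
      by (simp add: divide_simps) (simp add: algebra_simps)
    finally show ?thesis using z by (auto simp: Q_def p_def)
  qed
  have arc: "cmod (integral {-R..R} (\<lambda>t. Q (of_real t))) \<le> 8 * B * pi / R" if R: "R \<ge> 2 * cmod z + 1" for R
  proof -
    have R0: "R > 0" using R norm_ge_zero[of z] by linarith
    define \<gamma> where "\<gamma> = part_circlepath 0 R 0 pi"
    have path: "path_image (linepath (- of_real R) (of_real R)) \<subseteq> S"
    proof -
      have "closed_segment (- of_real R) (of_real R) \<subseteq> S"
        using S d z by (intro closed_segment_subset) (auto simp: S_def)
      then show ?thesis by simp
    qed
    have arcS: "Im w \<ge> 0" "cmod w = R" if w: "w \<in> path_image \<gamma>" for w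
    proof -
      obtain x where x: "0 \<le> x" "x \<le> pi" "w = of_real R * exp (\<i> * of_real x)"
        using w path_image_part_circlepath[of 0 pi 0 R] by (auto simp: \<gamma>_def)
      then show "Im w \<ge> 0" "cmod w = R" using R0 sin_ge_zero[of x]
        by (auto simp: norm_mult Im_exp)
    qed
    have \<gamma>S: "path_image \<gamma> \<subseteq> S" using arcS(1) d z by (force simp: S_def)
    have v: "valid_path \<gamma>" by (simp add: \<gamma>_def)
    have ends: "pathstart \<gamma> = of_real R" "pathfinish \<gamma> = - of_real R" by (auto simp: \<gamma>_def)
    have i1: "Q contour_integrable_on linepath (- of_real R) (of_real R)"
      using S holQ path by (intro contour_integrable_holomorphic_simple[of _ S]) auto
    have i2: "Q contour_integrable_on \<gamma>"
      using S holQ \<gamma>S v by (intro contour_integrable_holomorphic_simple[of _ S])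
    have "(Q has_contour_integral 0) (linepath (- of_real R) (of_real R) +++ \<gamma>)"
      using S holQ path \<gamma>S v ends
      by (intro Cauchy_theorem_convex_simple[of _ S]) (auto simp: valid_path_join path_image_join)
    then have "contour_integral (linepath (- of_real R) (of_real R)) Q + contour_integral \<gamma> Q = 0"
      using i1 i2 v by (metis contour_integral_join contour_integral_unique valid_path_linepath)
    then have "integral {-R..R} (\<lambda>t. Q (of_real t)) = - contour_integral \<gamma> Q"
      using R0 by (simp add: contour_integral_linepath_Reals_eq eq_neg_iff_add_eq_0)
    then have "cmod (integral {-R..R} (\<lambda>t. Q (of_real t))) = cmod (contour_integral \<gamma> Q)" by simp
    also have "\<dots> \<le> 2 * B / (R / 2 * (R / 2)) * R * \<bar>pi - 0\<bar>"
      unfolding \<gamma>_def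
    proof (rule contour_integral_bound_part_circlepath)
      show "Q contour_integrable_on part_circlepath 0 R 0 pi" using i2 by (simp add: \<gamma>_def)
      fix w assume "w \<in> path_image (part_circlepath 0 R 0 pi)"
      then have w: "Im w \<ge> 0" "cmod w = R" using arcS by (auto simp: \<gamma>_def)
      have far: "cmod (w - z) \<ge> R / 2" "cmod (w - cnj z) \<ge> R / 2"
        using norm_triangle_ineq2[of w z] norm_triangle_ineq2[of w "cnj z"] w R by auto
      then have "w \<noteq> z" using R0 by auto
      then have "cmod (Q w) = cmod (g w - g z) / (cmod (w - z) * cmod (w - cnj z))"
        by (simp add: Q_def p_def norm_divide norm_mult)
      also have "\<dots> \<le> 2 * B / (R / 2 * (R / 2))"
      proof (intro frac_le mult_mono far)
        show "cmod (g w - g z) \<le> 2 * B"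
          using norm_triangle_ineq4[of "g w" "g z"] bound[OF w(1)] bound[of z] z by linarith
      qed (use R0 B in auto)
      finally show "cmod (Q w) \<le> 2 * B / (R / 2 * (R / 2))" .
    qed (use R0 B in auto)
    also have "\<dots> = 8 * B * pi / R" using R0 by (simp add: field_simps)
    finally show ?thesis .
  qed
  have "((\<lambda>R. 8 * B * pi / R) \<longlongrightarrow> 0) at_top"
    by (intro real_tendsto_divide_at_top[OF tendsto_const] filterlim_ident)
  moreover have "\<forall>\<^sub>F R in at_top. norm (integral {-R..R} (\<lambda>t. Q (of_real t))) \<le> 8 * B * pi / R"
    using eventually_ge_at_top[of "2 * cmod z + 1"] by eventually_elim (rule arc)
  ultimately show ?thesis
    unfolding Qreal by (rule Lim_null_comparison[rotated])
qed

text \<open>Write g(t) as (g(t) - g(z)) + g(z). Against the kernel the first part vanishes in the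
  limit and the second contributes \<pi> times g(z). The sign condition makes the integrand
  nonnegative, so the limit over symmetric intervals is the full integral by monotone
  convergence.\<close>

lemma half_plane_poisson:
  fixes g :: "complex \<Rightarrow> complex"
  assumes hol: "g holomorphic_on {w. Im w > - d}" and d: "d > 0"
    and bound: "\<And>w. Im w \<ge> 0 \<Longrightarrow> cmod (g w) \<le> B"
    and neg: "\<And>t. Im (g (of_real t)) \<le> 0"
    and z: "Im z > 0"
  shows "(\<integral>\<^sup>+t. ennreal (- Im (g (of_real t)) * (Im z * (cmod (1 / (z - of_real t)))\<^sup>2)) \<partial>lborel)
       = ennreal (pi * - Im (g z))"
proof -
  define k where "k t = (cmod (1 / (z - of_real t)))\<^sup>2" for t
  define f where "f t = - Im (g (of_real t)) * (Im z * k t)" for t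
  have f0: "f t \<ge> 0" for t
    unfolding f_def using neg[of t] z by (intro mult_nonneg_nonneg) (auto simp: k_def)
  have contg: "continuous_on UNIV (\<lambda>t. g (of_real t))"
    using d by (intro continuous_on_compose2[OF holomorphic_on_imp_continuous_on[OF hol]] continuous_intros) auto
  have contk: "continuous_on UNIV k"
    unfolding k_def using minus_real_nonzero[OF z] by (intro continuous_intros) auto
  have contf: "continuous_on UNIV f"
    unfolding f_def by (intro continuous_intros contg contk)
  have kint: "((\<lambda>t. Im z * k t) has_integral arctan ((R - Re z) / Im z) - arctan ((- R - Re z) / Im z)) {-R..R}"
    if "R \<ge> 0" for R
  proof (rule fundamental_theorem_of_calculus)
    fix t
    have "cmod (Complex t (Im z) - of_real (Re z)) = cmod (z - of_real t)"
      by (simp add: cmod_def power2_commute)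
    then have "k t = (cmod (1 / (Complex t (Im z) - of_real (Re z))))\<^sup>2"
      by (simp add: k_def norm_divide)
    then have "((\<lambda>t. arctan ((t - Re z) / Im z)) has_real_derivative Im z * k t) (at t)"
      using arctan_kernel_derivative[OF z, of "Re z" t] by simp
    then show "((\<lambda>t. arctan ((t - Re z) / Im z)) has_vector_derivative Im z * k t) (at t within {-R..R})"
      by (simp add: has_real_derivative_iff_has_vector_derivative has_vector_derivative_at_within)
  qed (use that in auto)
  have Jeq: "integral {-R..R} f = - (Im z * Im (integral {-R..R} (\<lambda>t. (g (of_real t) - g z) * of_real (k t))))
      + - Im (g z) * (arctan ((R - Re z) / Im z) - arctan ((- R - Re z) / Im z))"
    if R: "R \<ge> 0" for R
  proof -
    have int1: "(\<lambda>t. (g (of_real t) - g z) * of_real (k t)) integrable_on {-R..R}"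
      by (intro integrable_continuous_interval continuous_intros
          continuous_on_subset[OF contg] continuous_on_subset[OF contk]) auto
    have "((\<lambda>t. - (Im z * Im ((g (of_real t) - g z) * of_real (k t))) + - Im (g z) * (Im z * k t)) has_integral
       - (Im z * Im (integral {-R..R} (\<lambda>t. (g (of_real t) - g z) * of_real (k t))))
       + - Im (g z) * (arctan ((R - Re z) / Im z) - arctan ((- R - Re z) / Im z))) {-R..R}"
      by (intro has_integral_add has_integral_neg has_integral_mult_right kint[OF R]
          has_integral_linear[OF integrable_integral[OF int1] bounded_linear_Im, unfolded comp_def])
    also have "(\<lambda>t. - (Im z * Im ((g (of_real t) - g z) * of_real (k t))) + - Im (g z) * (Im z * k t)) = f"
      by (simp add: f_def fun_eq_iff algebra_simps)
    finally show ?thesis by (rule integral_unique)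
  qed
  have lim_arctan: "((\<lambda>R. arctan ((R - Re z) / Im z) - arctan ((- R - Re z) / Im z)) \<longlongrightarrow> pi / 2 - - (pi / 2)) at_top"
  proof (intro tendsto_diff filterlim_compose[OF tendsto_arctan_at_top] filterlim_compose[OF tendsto_arctan_at_bot])
    show "filterlim (\<lambda>R. (R - Re z) / Im z) at_top at_top" using z by real_asymp
    show "filterlim (\<lambda>R. (- R - Re z) / Im z) at_bot at_top" using z by real_asymp
  qed
  have "((\<lambda>R. - (Im z * Im (integral {-R..R} (\<lambda>t. (g (of_real t) - g z) * of_real (k t))))
      + - Im (g z) * (arctan ((R - Re z) / Im z) - arctan ((- R - Re z) / Im z)))
      \<longlongrightarrow> - (Im z * Im 0) + - Im (g z) * (pi / 2 - - (pi / 2))) at_top"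
    unfolding k_def by (intro tendsto_intros lim_arctan half_plane_cauchy_difference[OF hol d bound z])
  moreover have "\<forall>\<^sub>F R in at_top. - (Im z * Im (integral {-R..R} (\<lambda>t. (g (of_real t) - g z) * of_real (k t))))
      + - Im (g z) * (arctan ((R - Re z) / Im z) - arctan ((- R - Re z) / Im z)) = integral {-R..R} f"
    using eventually_ge_at_top[of 0] by eventually_elim (simp add: Jeq)
  ultimately have "((\<lambda>R. integral {-R..R} f) \<longlongrightarrow> - (Im z * Im 0) + - Im (g z) * (pi / 2 - - (pi / 2))) at_top"
    by (rule Lim_transform_eventually)
  then have "((\<lambda>R. integral {-R..R} f) \<longlongrightarrow> pi * - Im (g z)) at_top" by (simp add: mult.commute)
  then have "(\<lambda>n. integral {-real n..real n} f) \<longlonglongrightarrow> pi * - Im (g z)"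
    by (rule filterlim_compose) (rule filterlim_real_sequentially)
  then have lim: "(\<lambda>n. ennreal (integral {-real n..real n} f)) \<longlonglongrightarrow> ennreal (pi * - Im (g z))"
    by (rule tendsto_ennrealI)
  have eq: "(\<integral>\<^sup>+t. ennreal (f t) * indicator {-real n..real n} t \<partial>lborel) = ennreal (integral {-real n..real n} f)" for n
    by (rule nn_integral_has_integral_lebesgue'[OF f0])
      (intro integrable_integral integrable_continuous_interval continuous_on_subset[OF contf], simp)
  have [measurable]: "f \<in> borel_measurable borel" by (rule borel_measurable_continuous_onI[OF contf])
  have "(\<lambda>n. \<integral>\<^sup>+t. ennreal (f t) * indicator {-real n..real n} t \<partial>lborel) \<longlonglongrightarrow> (\<integral>\<^sup>+t. ennreal (f t) \<partial>lborel)"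
  proof (rule nn_integral_LIMSEQ)
    show "incseq (\<lambda>n t. ennreal (f t) * indicator {-real n..real n} t)"
      by (auto simp: incseq_def le_fun_def indicator_def)
    fix t
    obtain n0 where n0: "\<bar>t\<bar> \<le> real n0" using real_arch_simple by blast
    have "\<forall>\<^sub>F n in sequentially. ennreal (f t) = ennreal (f t) * indicator {-real n..real n} t"
      using eventually_ge_at_top[of n0] by eventually_elim (use n0 in \<open>auto simp: indicator_def\<close>)
    then show "(\<lambda>n. ennreal (f t) * indicator {-real n..real n} t) \<longlonglongrightarrow> ennreal (f t)"
      by (rule Lim_transform_eventually[OF tendsto_const])
  qed measurable
  then have "(\<integral>\<^sup>+t. ennreal (f t) \<partial>lborel) = ennreal (pi * - Im (g z))"
    using lim unfolding eq by (rule LIMSEQ_unique)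
  then show ?thesis by (simp add: f_def k_def)
qed

section \<open>Existence of measures with a given reciprocal Cauchy transform\<close>

text \<open>Otherwise the image would be open, but the real line contains no disc. It serves to pass
  from equal imaginary parts to equality up to a constant.\<close>

lemma holomorphic_real_valued_constant:
  assumes hol: "f holomorphic_on S" and S: "open S" "connected S" and real: "\<And>z. z \<in> S \<Longrightarrow> Im (f z) = 0"
  shows "f constant_on S"
proof (rule ccontr)
  assume nc: "\<not> f constant_on S"
  then have "S \<noteq> {}" by (auto simp: constant_on_def)
  then obtain z where z: "z \<in> S" by blast
  have "open (f ` S)" by (rule open_mapping_thm[OF hol S S(1) order_refl nc])
  then obtain e where e: "e > 0" "ball (f z) e \<subseteq> f ` S" using z by (auto simp: open_contains_ball)
  have "f z + Complex 0 (e / 2) \<in> ball (f z) e"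
    using e(1) by (auto simp: dist_norm cmod_def)
  then have "f z + Complex 0 (e / 2) \<in> f ` S" using e(2) by blast
  then have "Im (f z + Complex 0 (e / 2)) = 0" using real by force
  then show False using e(1) real[OF z] by simp
qed

text \<open>After a shift by \<open>\<epsilon>\<close> the boundary values are smooth, and the measure is given by the density
  of the Stieltjes inversion formula.\<close>
lemma shifted_cauchy_transform_exists:
  fixes F :: "complex \<Rightarrow> complex"
  assumes hol: "F holomorphic_on upper_half_plane"
    and Im_ge: "\<And>z. Im z > 0 \<Longrightarrow> Im (F z) \<ge> Im z"
    and lim: "((\<lambda>y. F (Complex 0 y) / Complex 0 y) \<longlongrightarrow> 1) at_top"
    and \<epsilon>: "\<epsilon> > 0"
  shows "\<exists>\<rho>. real_distribution \<rho> \<and> (\<forall>z. Im z > 0 \<longrightarrow> cauchy_transform \<rho> z = 1 / F (z + Complex 0 \<epsilon>))"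
proof -
  define g where "g w = 1 / F (w + Complex 0 \<epsilon>)" for w
  have F_pos: "Im (F (w + Complex 0 \<epsilon>)) \<ge> Im w + \<epsilon>" if "Im w > - \<epsilon>" for w
    using Im_ge[of "w + Complex 0 \<epsilon>"] that by simp
  have F_nz: "F (w + Complex 0 \<epsilon>) \<noteq> 0" if "Im w > - \<epsilon>" for w
    using F_pos[OF that] that by auto
  have holg: "g holomorphic_on {w. Im w > - \<epsilon>}"
  proof -
    have "(F \<circ> (\<lambda>w. w + Complex 0 \<epsilon>)) holomorphic_on {w. Im w > - \<epsilon>}"
      by (intro holomorphic_on_compose_gen[OF _ hol] holomorphic_intros) (auto simp: upper_half_plane_def)
    then show ?thesis unfolding g_def using F_nz by (intro holomorphic_intros) (auto simp: comp_def)
  qed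
  have g_le: "cmod (g w) \<le> 1 / (Im w + \<epsilon>)" if "Im w \<ge> 0" for w
    unfolding g_def norm_divide
    using F_pos[of w] that \<epsilon> abs_Im_le_cmod[of "F (w + Complex 0 \<epsilon>)"] by (intro frac_le) auto
  have g_bound: "cmod (g w) \<le> 1 / \<epsilon>" if "Im w \<ge> 0" for w
    using g_le[OF that] frac_le[of 1 1 \<epsilon> "Im w + \<epsilon>"] that \<epsilon> by simp
  have g_neg: "Im (g w) \<le> 0" if "Im w \<ge> 0" for w
    using F_pos[of w] that \<epsilon> by (simp add: g_def Im_divide divide_nonpos_nonneg)
  \<comment> \<open>Up to the factor 1 / \<pi> this is the density of the measure sought.\<close>
  define p where "p t = - Im (g (of_real t))" for t
  have p0: "p t \<ge> 0" for t using g_neg[of "of_real t"] by (simp add: p_def)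
  have contp: "continuous_on UNIV p"
    unfolding p_def using \<epsilon>
    by (intro continuous_intros continuous_on_compose2[OF holomorphic_on_imp_continuous_on[OF holg]]) auto
  have [measurable]: "p \<in> borel_measurable borel" by (rule borel_measurable_continuous_onI[OF contp])
  define k where "k z t = (cmod (1 / (z - complex_of_real t)))\<^sup>2" for z t
  have [measurable]: "k z \<in> borel_measurable borel" for z unfolding k_def by measurable
  have k0: "k z t \<ge> 0" for z t by (simp add: k_def)
  have poisson: "(\<integral>\<^sup>+t. ennreal (p t * (Im z * k z t)) \<partial>lborel) = ennreal (pi * - Im (g z))" if "Im z > 0" for z
    unfolding p_def k_def using g_neg g_bound \<epsilon> by (intro half_plane_poisson[OF holg \<epsilon> _ _ that]) auto
  have inf: "filterlim (\<lambda>n. real (Suc n)) at_top sequentially"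
    using filterlim_real_sequentially filterlim_Suc by (rule filterlim_compose)

  \<comment> \<open>The normalisation of F, read along the imaginary axis; the factor y /
    (\<epsilon> + y), with y = n + 1, undoes the shift of the argument.\<close>
  have lim_g: "(\<lambda>n. real (Suc n) * - Im (g (Complex 0 (real (Suc n))))) \<longlonglongrightarrow> 1"
  proof -
    have f1: "filterlim (\<lambda>n. \<epsilon> + real (Suc n)) at_top sequentially"
      by (intro filterlim_tendsto_add_at_top[OF tendsto_const] inf)
    have "(\<lambda>n. F (Complex 0 (\<epsilon> + real (Suc n))) / Complex 0 (\<epsilon> + real (Suc n))) \<longlonglongrightarrow> 1"
      by (rule filterlim_compose[OF lim f1])
    then have l1: "(\<lambda>n. 1 / (F (Complex 0 (\<epsilon> + real (Suc n))) / Complex 0 (\<epsilon> + real (Suc n)))) \<longlonglongrightarrow> 1 / 1"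
      by (intro tendsto_intros) auto
    have "(\<lambda>n. \<epsilon> / (\<epsilon> + real (Suc n))) \<longlonglongrightarrow> 0"
      by (rule real_tendsto_divide_at_top[OF tendsto_const f1])
    then have l2: "(\<lambda>n. 1 - \<epsilon> / (\<epsilon> + real (Suc n))) \<longlonglongrightarrow> 1 - 0" by (intro tendsto_intros)
    have "(\<lambda>n. Re (1 / (F (Complex 0 (\<epsilon> + real (Suc n))) / Complex 0 (\<epsilon> + real (Suc n)))
        * of_real (1 - \<epsilon> / (\<epsilon> + real (Suc n))))) \<longlonglongrightarrow> Re (1 / 1 * of_real (1 - 0))"
      by (intro tendsto_intros l1 l2)
    also have "(\<lambda>n. Re (1 / (F (Complex 0 (\<epsilon> + real (Suc n))) / Complex 0 (\<epsilon> + real (Suc n)))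
        * of_real (1 - \<epsilon> / (\<epsilon> + real (Suc n))))) = (\<lambda>n. real (Suc n) * - Im (g (Complex 0 (real (Suc n)))))"
    proof
      fix n
      define x where "x = real (Suc n)"
      have x: "\<epsilon> + x > 0" using \<epsilon> by (simp add: x_def add_pos_pos)
      have gen: "1 / (a / b) * r = b * r * (1 / a)" for a b r :: complex by simp
      have "1 - \<epsilon> / (\<epsilon> + x) = x / (\<epsilon> + x)" using x by (simp add: field_simps)
      moreover have "Complex 0 (\<epsilon> + x) * of_real (x / (\<epsilon> + x)) = \<i> * of_real x"
        using x by (simp add: complex_eq_iff)
      ultimately have E1: "1 / (F (Complex 0 (\<epsilon> + x)) / Complex 0 (\<epsilon> + x)) * of_real (1 - \<epsilon> / (\<epsilon> + x))
          = \<i> * of_real x * (1 / F (Complex 0 (\<epsilon> + x)))" unfolding gen by (simp only:)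
      have E2: "Complex 0 x + Complex 0 \<epsilon> = Complex 0 (\<epsilon> + x)" by (simp add: complex_eq_iff)
      have E3: "Re (\<i> * of_real x * w) = x * - Im w" for w by simp
      show "Re (1 / (F (Complex 0 (\<epsilon> + real (Suc n))) / Complex 0 (\<epsilon> + real (Suc n)))
        * of_real (1 - \<epsilon> / (\<epsilon> + real (Suc n)))) = real (Suc n) * - Im (g (Complex 0 (real (Suc n))))"
        unfolding x_def[symmetric] g_def E1 E2 by (rule E3)
    qed
    finally show ?thesis by simp
  qed

  have total: "(\<integral>\<^sup>+t. ennreal (p t) \<partial>lborel) = ennreal pi"
  proof -
    \<comment> \<open>y times the Poisson kernel at i y, that is y^2 / (t^2 + y^2), increases to 1
      with y. Monotone convergence thus turns the Poisson formula on the imaginary axis into the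
      total mass.\<close>
    define m where "m n t = real (Suc n) * (real (Suc n) * k (Complex 0 (real (Suc n))) t)" for n t
    have m_eq: "m n t = 1 - t\<^sup>2 / (t\<^sup>2 + (real (Suc n))\<^sup>2)" for n t
    proof -
      have "t\<^sup>2 + (real (Suc n))\<^sup>2 > 0" by (intro add_nonneg_pos) auto
      then show ?thesis
        by (simp add: m_def k_def norm_divide power_divide cmod_power2 divide_simps) (simp add: power2_eq_square)
    qed
    have "(\<lambda>n. \<integral>\<^sup>+t. ennreal (p t * m n t) \<partial>lborel) \<longlonglongrightarrow> (\<integral>\<^sup>+t. ennreal (p t) \<partial>lborel)"
    proof (rule nn_integral_LIMSEQ)
      have "m i t \<le> m j t" if "i \<le> j" for i j t
      proof -
        have "(real (Suc i))\<^sup>2 \<le> (real (Suc j))\<^sup>2" using that by (intro power_mono) auto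
        then show ?thesis unfolding m_eq by (intro diff_left_mono frac_le add_nonneg_pos) auto
      qed
      then show "incseq (\<lambda>n t. ennreal (p t * m n t))"
        using p0 by (auto simp: incseq_def le_fun_def intro!: ennreal_leI mult_left_mono)
      have [measurable]: "m n \<in> borel_measurable borel" for n unfolding m_def by measurable
      show "(\<lambda>t. ennreal (p t * m n t)) \<in> borel_measurable lborel" for n by measurable
      fix t
      have "filterlim (\<lambda>n. t\<^sup>2 + (real (Suc n))\<^sup>2) at_top sequentially"
        unfolding power2_eq_square
        by (intro filterlim_tendsto_add_at_top[OF tendsto_const] filterlim_at_top_mult_at_top inf)
      then have "(\<lambda>n. t\<^sup>2 / (t\<^sup>2 + (real (Suc n))\<^sup>2)) \<longlonglongrightarrow> 0"
        by (rule real_tendsto_divide_at_top[OF tendsto_const])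
      then have "(\<lambda>n. ennreal (p t * m n t)) \<longlonglongrightarrow> ennreal (p t * (1 - 0))"
        unfolding m_eq by (intro tendsto_intros)
      then show "(\<lambda>n. ennreal (p t * m n t)) \<longlonglongrightarrow> ennreal (p t)" by simp
    qed
    moreover have "(\<integral>\<^sup>+t. ennreal (p t * m n t) \<partial>lborel) = ennreal (pi * (real (Suc n) * - Im (g (Complex 0 (real (Suc n))))))" for n
    proof -
      have "(\<integral>\<^sup>+t. ennreal (p t * m n t) \<partial>lborel)
          = (\<integral>\<^sup>+t. ennreal (real (Suc n)) * ennreal (p t * (Im (Complex 0 (real (Suc n))) * k (Complex 0 (real (Suc n))) t)) \<partial>lborel)"
      proof (rule nn_integral_cong)
        fix t
        have eq: "p t * m n t = real (Suc n) * (p t * (Im (Complex 0 (real (Suc n))) * k (Complex 0 (real (Suc n))) t))"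
          by (simp add: m_def mult_ac del: of_nat_Suc)
        show "ennreal (p t * m n t)
            = ennreal (real (Suc n)) * ennreal (p t * (Im (Complex 0 (real (Suc n))) * k (Complex 0 (real (Suc n))) t))"
          unfolding eq by (rule ennreal_mult') simp
      qed
      also have "\<dots> = ennreal (real (Suc n)) * ennreal (pi * - Im (g (Complex 0 (real (Suc n)))))"
        by (subst nn_integral_cmult) (measurable, subst poisson, simp_all)
      also have "\<dots> = ennreal (pi * (real (Suc n) * - Im (g (Complex 0 (real (Suc n))))))"
        by (subst ennreal_mult'[symmetric]) (simp_all add: mult_ac)
      finally show ?thesis .
    qed
    moreover have "(\<lambda>n. ennreal (pi * (real (Suc n) * - Im (g (Complex 0 (real (Suc n))))))) \<longlonglongrightarrow> ennreal (pi * 1)"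
      by (intro tendsto_ennrealI tendsto_mult tendsto_const lim_g)
    ultimately show ?thesis using LIMSEQ_unique by force
  qed

  define \<rho> where "\<rho> = density lborel (\<lambda>t. ennreal (1 / pi) * ennreal (p t))"
  have "emeasure \<rho> (space \<rho>) = (\<integral>\<^sup>+t. ennreal (1 / pi) * ennreal (p t) \<partial>lborel)"
    by (simp add: \<rho>_def emeasure_density)
  also have "\<dots> = ennreal (1 / pi) * ennreal pi"
    by (subst nn_integral_cmult) (simp_all add: total)
  also have "\<dots> = 1" by (simp add: ennreal_mult[symmetric])
  finally have "prob_space \<rho>" by (rule prob_spaceI)
  then have \<rho>: "real_distribution \<rho>"
    by (intro real_distribution.intro) (auto simp: real_distribution_axioms_def \<rho>_def)
  interpret R: real_distribution \<rho> by fact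
  have Im_eq: "Im (cauchy_transform \<rho> z) = Im (g z)" if z: "Im z > 0" for z
  proof -
    have "ennreal (- Im (cauchy_transform \<rho> z)) = ennreal (LINT t|\<rho>. Im z * k z t)"
      using R.Im_cauchy_transform[OF z] by (simp add: k_def)
    also have "\<dots> = (\<integral>\<^sup>+t. ennreal (Im z * k z t) \<partial>\<rho>)"
      using z R.integrable_cauchy_kernel_sq[OF z]
      by (intro nn_integral_eq_integral[symmetric]) (auto simp: k_def)
    also have "\<dots> = (\<integral>\<^sup>+t. ennreal (1 / pi) * ennreal (p t) * ennreal (Im z * k z t) \<partial>lborel)"
      unfolding \<rho>_def by (subst nn_integral_density) auto
    also have "\<dots> = (\<integral>\<^sup>+t. ennreal (1 / pi) * ennreal (p t * (Im z * k z t)) \<partial>lborel)"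
      using p0 k0 z by (intro nn_integral_cong) (simp add: ennreal_mult mult.assoc)
    also have "\<dots> = ennreal (1 / pi) * ennreal (pi * - Im (g z))"
      by (subst nn_integral_cmult) (simp_all only: poisson[OF z], measurable)
    also have "\<dots> = ennreal (- Im (g z))"
      by (subst ennreal_mult'[symmetric]) auto
    finally show ?thesis using R.Im_cauchy_transform_neg[OF z] g_neg[of z] z by simp
  qed
  define D where "D z = cauchy_transform \<rho> z - g z" for z
  have "D constant_on upper_half_plane"
  proof (rule holomorphic_real_valued_constant)
    show "D holomorphic_on upper_half_plane"
      unfolding D_def using \<epsilon>
      by (intro holomorphic_intros R.holomorphic_cauchy_transform holomorphic_on_subset[OF holg])
        (auto simp: upper_half_plane_def)
  qed (auto simp: open_upper_half_plane convex_connected convex_upper_half_plane D_def Im_eq upper_half_plane_iff)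
  then obtain c where c: "\<And>z. Im z > 0 \<Longrightarrow> D z = c" by (auto simp: constant_on_def upper_half_plane_iff)
  have "c = 0"
  proof (rule ccontr)
    assume "c \<noteq> 0"
    \<comment> \<open>Both transforms are at most 1 / y in modulus at i y, so |c| is at most 2 / y,
      which for this y is only two thirds of |c|.\<close>
    define y where "y = 3 / cmod c"
    have y: "y > 0" using \<open>c \<noteq> 0\<close> by (simp add: y_def)
    have "cmod (cauchy_transform \<rho> (Complex 0 y)) \<le> 1 / y"
      using R.norm_cauchy_transform_le[of "Complex 0 y"] y by simp
    moreover have "cmod (g (Complex 0 y)) \<le> 1 / y"
      using g_le[of "Complex 0 y"] y \<epsilon> frac_le[of 1 1 y "y + \<epsilon>"] by simp
    ultimately have "cmod c \<le> 2 / y"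
      using c[of "Complex 0 y"] y norm_triangle_ineq4[of "cauchy_transform \<rho> (Complex 0 y)" "g (Complex 0 y)"]
      by (simp add: D_def)
    then show False using \<open>c \<noteq> 0\<close> by (simp add: y_def)
  qed
  then show ?thesis using \<rho> c by (auto simp: D_def g_def)
qed

text \<open>The measures belonging to the shifts 1 / (n + 1) are tight, since the limit of F(i y) /
  (i y) bounds their tails uniformly in n. Along a weakly convergent subsequence the Cauchy
  transforms converge, the kernel being bounded and continuous in s.\<close>

lemma reciprocal_cauchy_transform_exists:
  fixes F :: "complex \<Rightarrow> complex"
  assumes hol: "F holomorphic_on upper_half_plane"
    and Im_ge: "\<And>z. Im z > 0 \<Longrightarrow> Im (F z) \<ge> Im z"
    and lim: "((\<lambda>y. F (Complex 0 y) / Complex 0 y) \<longlongrightarrow> 1) at_top"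
  obtains \<rho> where "real_distribution \<rho>" "\<And>z. Im z > 0 \<Longrightarrow> recip_cauchy \<rho> z = F z"
proof -
  define e where "e n = 1 / real (Suc n)" for n
  have e: "e n > 0" "e n \<le> 1" for n by (auto simp: e_def)
  have e_lim: "e \<longlonglongrightarrow> 0" unfolding e_def using LIMSEQ_inverse_real_of_nat by (simp add: inverse_eq_divide)
  obtain \<rho> where \<rho>: "\<And>n. real_distribution (\<rho> n)"
    and \<rho>F: "\<And>n z. Im z > 0 \<Longrightarrow> cauchy_transform (\<rho> n) z = 1 / F (z + Complex 0 (e n))"
    using shifted_cauchy_transform_exists[OF hol Im_ge lim e(1)] by metis
  have lim_w: "((\<lambda>y. - (y * Im (1 / F (Complex 0 y)))) \<longlongrightarrow> 1) at_top"
  proof -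
    have "((\<lambda>y. Re (1 / (F (Complex 0 y) / Complex 0 y))) \<longlongrightarrow> Re (1 / 1)) at_top"
      by (intro tendsto_intros lim) auto
    moreover have "(\<lambda>y. Re (1 / (F (Complex 0 y) / Complex 0 y))) = (\<lambda>y. - (y * Im (1 / F (Complex 0 y))))"
      by (simp add: fun_eq_iff Re_divide Im_divide)
    ultimately show ?thesis by simp
  qed
  have "tight \<rho>"
    unfolding tight_def
  proof (intro conjI allI impI \<rho>)
    fix \<eta> :: real assume \<eta>: "\<eta> > 0"
    \<comment> \<open>The chain below gives 1 - 2 q < 1/2 + P / 2, hence P > 1 - 4 q, which is at
      least 1 - \<eta>.\<close>
    define q where "q = min (1 / 2) (\<eta> / 4)"
    have q: "q > 0" "q \<le> 1 / 2" "4 * q \<le> \<eta>" using \<eta> by (auto simp: q_def)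
    have "\<forall>\<^sub>F y in at_top. - (y * Im (1 / F (Complex 0 y))) > 1 - q"
      using q by (intro order_tendstoD(1)[OF lim_w]) auto
    then obtain Y where Y: "\<And>y. y \<ge> Y \<Longrightarrow> - (y * Im (1 / F (Complex 0 y))) > 1 - q"
      by (auto simp: eventually_at_top_linorder)
    \<comment> \<open>\<open>Y\<close> makes the asymptotics available at y + e n for all n at once;
      \<open>1 / q\<close> makes the shift, at most 1, negligible in the ratio y / (y + e
      n).\<close>
    define y where "y = max (max Y 1) (1 / q)"
    have y: "y \<ge> Y" "y > 0" "1 / q \<le> y" by (auto simp: y_def)
    show "\<exists>a b. a < b \<and> (\<forall>n. 1 - \<eta> < measure (\<rho> n) {a<..b})"
    proof (intro exI conjI allI)
      show "- y < y" using y by simp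
      fix n
      interpret R: real_distribution "\<rho> n" by (rule \<rho>)
      define A where "A = (LINT s|\<rho> n. (cmod (1 / (Complex 0 y - complex_of_real s)))\<^sup>2)"
      define P where "P = measure (\<rho> n) {-y<..y}"
      have "1 - 2 * q \<le> (1 - q) * (1 - q)" by (simp add: algebra_simps)
      also have "\<dots> < (1 - q) * - ((y + e n) * Im (1 / F (Complex 0 (y + e n))))"
        using q Y[of "y + e n"] y e(1)[of n] by (intro mult_strict_left_mono) auto
      also have "\<dots> \<le> y / (y + e n) * - ((y + e n) * Im (1 / F (Complex 0 (y + e n))))"
      proof (rule mult_right_mono)
        have "1 \<le> q * y" using y(3) q by (simp add: field_simps)
        moreover have "e n * (1 - q) \<le> 1 * 1" using e[of n] q by (intro mult_mono) auto
        ultimately have "(1 - q) * (y + e n) \<le> y" by (simp add: algebra_simps)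
        then show "1 - q \<le> y / (y + e n)" using y(2) e(1)[of n] by (simp add: pos_le_divide_eq)
        show "0 \<le> - ((y + e n) * Im (1 / F (Complex 0 (y + e n))))"
          using q Y[of "y + e n"] y e(1)[of n] by auto
      qed
      also have "\<dots> = - (y * Im (1 / F (Complex 0 (y + e n))))"
        using y(2) e(1)[of n] by simp
      also have "\<dots> = - (y * Im (cauchy_transform (\<rho> n) (Complex 0 y)))"
      proof -
        have "Complex 0 y + Complex 0 (e n) = Complex 0 (y + e n)" by (simp add: complex_eq_iff)
        then show ?thesis using \<rho>F[of "Complex 0 y" n] y(2) by simp
      qed
      also have "\<dots> = y\<^sup>2 * A"
        using R.Im_cauchy_transform[of "Complex 0 y"] y(2) by (simp add: A_def power2_eq_square)
      also have "\<dots> = (LINT s|\<rho> n. y\<^sup>2 * (cmod (1 / (Complex 0 y - complex_of_real s)))\<^sup>2)"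
        unfolding A_def by (rule integral_mult_right_zero[symmetric])
      \<comment> \<open>The function y^2 / (s^2 + y^2) is at most 1 everywhere and at most 1/2 once
        |s| reaches y.\<close>
      also have "\<dots> \<le> (LINT s|\<rho> n. 1 / 2 + 1 / 2 * indicator {-y<..y} s)"
      proof (rule integral_mono)
        show "integrable (\<rho> n) (\<lambda>s. y\<^sup>2 * (cmod (1 / (Complex 0 y - complex_of_real s)))\<^sup>2)"
          using y by (intro integrable_mult_right R.integrable_cauchy_kernel_sq) auto
        show "integrable (\<rho> n) (\<lambda>s. 1 / 2 + 1 / 2 * indicator {-y<..y} s :: real)"
          by (intro R.integrable_bounded[where B=1]) (auto simp: indicator_def)
        fix s
        have "y\<^sup>2 * (cmod (1 / (Complex 0 y - complex_of_real s)))\<^sup>2 = y\<^sup>2 / (s\<^sup>2 + y\<^sup>2)"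
          by (simp add: norm_divide power_divide cmod_power2)
        also have "\<dots> \<le> 1 / 2 + 1 / 2 * indicator {-y<..y} s"
        proof (cases "s \<in> {-y<..y}")
          case True
          then show ?thesis using y(2) by (simp add: divide_le_eq_1 add_nonneg_pos)
        next
          case False
          then have "y\<^sup>2 \<le> s\<^sup>2" using y(2) by (auto simp: abs_le_square_iff[symmetric])
          moreover have "s\<^sup>2 + y\<^sup>2 > 0" using y(2) by (intro add_nonneg_pos) auto
          ultimately have "y\<^sup>2 / (s\<^sup>2 + y\<^sup>2) \<le> 1 / 2" by (simp add: pos_divide_le_eq)
          then show ?thesis using False by simp
        qed
        finally show "y\<^sup>2 * (cmod (1 / (Complex 0 y - complex_of_real s)))\<^sup>2 \<le> 1 / 2 + 1 / 2 * indicator {-y<..y} s" .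
      qed
      also have "\<dots> = 1 / 2 + 1 / 2 * P"
        by (subst Bochner_Integration.integral_add) (auto simp: P_def R.prob_UNIV R.emeasure_eq_measure)
      finally show "1 - \<eta> < measure (\<rho> n) {-y<..y}" using q(3) by (simp add: P_def)
    qed
  qed
  then obtain r M where r: "strict_mono r" and M: "real_distribution M" and conv: "weak_conv_m (\<rho> \<circ> id \<circ> r) M"
    using tight_imp_convergent_subsubsequence[OF _ strict_mono_id] by blast
  show ?thesis
  proof (rule that[OF M])
    fix z :: complex assume z: "Im z > 0"
    have "(\<lambda>n. integral\<^sup>L ((\<rho> \<circ> id \<circ> r) n) (\<lambda>s. 1 / (z - complex_of_real s))) \<longlonglongrightarrow> integral\<^sup>L M (\<lambda>s. 1 / (z - complex_of_real s))"
    proof (rule weak_conv_imp_integral_bdd_continuous_conv[OF _ M conv])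
      show "real_distribution ((\<rho> \<circ> id \<circ> r) n)" for n using \<rho> by simp
      show "isCont (\<lambda>s. 1 / (z - complex_of_real s)) s" for s
        using minus_real_nonzero[OF z] by (intro continuous_intros) auto
      show "norm (1 / (z - complex_of_real s)) \<le> 1 / Im z" for s by (rule norm_cauchy_kernel_le[OF z])
    qed
    then have "(\<lambda>n. cauchy_transform (\<rho> (r n)) z) \<longlonglongrightarrow> cauchy_transform M z"
      by (simp add: cauchy_transform_def)
    then have l1: "(\<lambda>n. 1 / F (z + Complex 0 (e (r n)))) \<longlonglongrightarrow> cauchy_transform M z"
      using z by (simp add: \<rho>F)
    have "(\<lambda>n. z + Complex 0 (e (r n))) \<longlonglongrightarrow> z + Complex 0 0"
      using LIMSEQ_subseq_LIMSEQ[OF e_lim r] by (intro tendsto_intros) (simp add: comp_def)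
    then have l2: "(\<lambda>n. z + Complex 0 (e (r n))) \<longlonglongrightarrow> z" by (simp add: complex_eq_iff flip: zero_complex.code)
    have "isCont F z"
      using holomorphic_on_imp_continuous_on[OF hol] open_upper_half_plane z
      by (simp add: continuous_on_eq_continuous_at upper_half_plane_iff)
    then have "(\<lambda>n. F (z + Complex 0 (e (r n)))) \<longlonglongrightarrow> F z" using l2 by (rule isCont_tendsto_compose)
    moreover have Fz: "F z \<noteq> 0" using Im_ge[OF z] z by auto
    ultimately have "(\<lambda>n. 1 / F (z + Complex 0 (e (r n)))) \<longlonglongrightarrow> 1 / F z" by (intro tendsto_intros)
    then have "cauchy_transform M z = 1 / F z" using l1 LIMSEQ_unique by blast
    then show "recip_cauchy M z = F z" by (simp add: recip_cauchy_def)
  qed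
qed

section \<open>Right inverses and free convolution\<close>

lemma open_truncated_cone: "open (truncated_cone \<alpha> \<beta>)"
proof -
  have "truncated_cone \<alpha> \<beta> = {z. 0 < Im z} \<inter> {z. \<bar>Re z\<bar> < \<alpha> * Im z} \<inter> {z. \<beta> < Im z}"
    by (auto simp: truncated_cone_iff)
  then show ?thesis by (simp only:) (intro open_Int open_Collect_less continuous_intros)
qed

lemma imaginary_in_truncated_cone:
  "\<alpha> > 0 \<Longrightarrow> y > 0 \<Longrightarrow> y > \<beta> \<Longrightarrow> Complex 0 y \<in> truncated_cone \<alpha> \<beta>"
  by (simp add: truncated_cone_iff)

text \<open>Inside a cone |z| and Im z are comparable, so tending to infinity means gaining height.
  This trades the filter for bounds that can be combined with the contraction results.\<close>

lemma truncated_cone_limit_iff: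
  assumes "\<alpha> > 0"
  shows "((\<lambda>z. f z / z) \<longlongrightarrow> 1) (inf at_infinity (principal (truncated_cone \<alpha> \<beta>))) \<longleftrightarrow>
    (\<forall>r>0. \<exists>\<beta>'>0. \<forall>z\<in>truncated_cone \<alpha> (max \<beta> \<beta>'). cmod (f z - z) \<le> r * cmod z)"
proof -
  have dist: "dist (f z / z) 1 = cmod (f z - z) / cmod z" "cmod z > 0" if "z \<in> truncated_cone \<alpha> \<beta>" for z \<beta>
  proof -
    have "z \<noteq> 0" using that by (auto simp: truncated_cone_iff)
    then show "cmod z > 0" by simp
    have "f z / z - 1 = (f z - z) / z" using \<open>z \<noteq> 0\<close> by (simp add: field_simps)
    then show "dist (f z / z) 1 = cmod (f z - z) / cmod z" by (simp add: dist_norm norm_divide)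
  qed
  show ?thesis
  proof
    assume L: "((\<lambda>z. f z / z) \<longlongrightarrow> 1) (inf at_infinity (principal (truncated_cone \<alpha> \<beta>)))"
    show "\<forall>r>0. \<exists>\<beta>'>0. \<forall>z\<in>truncated_cone \<alpha> (max \<beta> \<beta>'). cmod (f z - z) \<le> r * cmod z"
    proof (intro allI impI)
      fix r :: real assume "r > 0"
      with L obtain b where b: "\<And>z. b \<le> cmod z \<Longrightarrow> z \<in> truncated_cone \<alpha> \<beta> \<Longrightarrow> dist (f z / z) 1 < r"
        unfolding tendsto_iff eventually_inf_principal eventually_at_infinity by blast
      have "cmod (f z - z) \<le> r * cmod z" if z: "z \<in> truncated_cone \<alpha> (max \<beta> (max b 1))" for z
      proof -
        have z': "z \<in> truncated_cone \<alpha> \<beta>" "b < Im z" using z by (auto simp: truncated_cone_iff)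
        then have "dist (f z / z) 1 < r" using b[of z] abs_Im_le_cmod[of z] by linarith
        then show ?thesis using dist[OF z'(1)] by (simp add: pos_divide_less_eq)
      qed
      then show "\<exists>\<beta>'>0. \<forall>z\<in>truncated_cone \<alpha> (max \<beta> \<beta>'). cmod (f z - z) \<le> r * cmod z"
        by (intro exI[of _ "max b 1"]) auto
    qed
  next
    assume R: "\<forall>r>0. \<exists>\<beta>'>0. \<forall>z\<in>truncated_cone \<alpha> (max \<beta> \<beta>'). cmod (f z - z) \<le> r * cmod z"
    show "((\<lambda>z. f z / z) \<longlongrightarrow> 1) (inf at_infinity (principal (truncated_cone \<alpha> \<beta>)))"
      unfolding tendsto_iff eventually_inf_principal eventually_at_infinity
    proof (intro allI impI)
      fix r :: real assume r: "r > 0"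
      then have "r / 2 > 0" by simp
      with R obtain \<beta>' where \<beta>': "\<beta>' > 0" "\<And>z. z \<in> truncated_cone \<alpha> (max \<beta> \<beta>') \<Longrightarrow> cmod (f z - z) \<le> r / 2 * cmod z"
        by blast
      have "dist (f z / z) 1 < r" if z: "(1 + \<alpha>) * (\<beta>' + 1) \<le> cmod z" "z \<in> truncated_cone \<alpha> \<beta>" for z
      proof -
        have "(1 + \<alpha>) * (\<beta>' + 1) \<le> (1 + \<alpha>) * Im z" using z cmod_le_in_truncated_cone[OF z(2)] by linarith
        then have "\<beta>' < Im z" using assms by simp
        then have "z \<in> truncated_cone \<alpha> (max \<beta> \<beta>')" using z(2) by (auto simp: truncated_cone_iff)
        from \<beta>'(2)[OF this] have "cmod (f z - z) / cmod z \<le> r / 2"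
          using dist(2)[OF z(2)] by (simp add: pos_divide_le_eq)
        then show ?thesis unfolding dist(1)[OF z(2)] using r by linarith
      qed
      then show "\<exists>b. \<forall>z. b \<le> cmod z \<longrightarrow> z \<in> truncated_cone \<alpha> \<beta> \<longrightarrow> dist (f z / z) 1 < r" by blast
    qed
  qed
qed

lemma imaginary_axis_limit:
  assumes "\<And>r. r > 0 \<Longrightarrow> \<exists>\<beta>>0. \<forall>z\<in>truncated_cone 1 \<beta>. cmod (f z - z) \<le> r * cmod z"
  shows "((\<lambda>y. f (Complex 0 y) / Complex 0 y) \<longlongrightarrow> 1) at_top"
proof (rule tendstoI)
  fix r :: real assume r: "r > 0"
  then obtain \<beta> where \<beta>: "\<beta> > 0" "\<And>z. z \<in> truncated_cone 1 \<beta> \<Longrightarrow> cmod (f z - z) \<le> r / 2 * cmod z"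
    using assms[of "r / 2"] by auto
  show "\<forall>\<^sub>F y in at_top. dist (f (Complex 0 y) / Complex 0 y) 1 < r"
    using eventually_gt_at_top[of \<beta>]
  proof eventually_elim
    case (elim y)
    define z where "z = Complex 0 y"
    have z: "z \<in> truncated_cone 1 \<beta>" "cmod z > 0" using elim \<beta>(1) by (auto simp: z_def truncated_cone_iff cmod_def)
    have "f z / z - 1 = (f z - z) / z" using z(2) by (auto simp: field_simps)
    then have "dist (f z / z) 1 = cmod (f z - z) / cmod z" by (simp add: dist_norm norm_divide)
    also have "\<dots> \<le> r / 2" using \<beta>(2)[OF z(1)] z(2) by (simp add: pos_divide_le_eq)
    finally show ?case using r by (simp add: z_def)
  qed
qed

section \<open>Uniqueness of right inverses, V-transforms and free convolutions\<close>

lemma right_inverse_on_mono: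
  assumes "right_inverse_on \<mu> \<alpha> \<beta> f" "\<alpha>' \<le> \<alpha>" "\<beta> \<le> \<beta>'"
  shows "right_inverse_on \<mu> \<alpha>' \<beta>' f"
proof -
  have sub: "truncated_cone \<alpha>' \<beta>' \<subseteq> truncated_cone \<alpha> \<beta>" using assms(2,3) by (rule truncated_cone_mono)
  have le: "inf at_infinity (principal (truncated_cone \<alpha>' \<beta>')) \<le> inf at_infinity (principal (truncated_cone \<alpha> \<beta>))"
    using sub by (intro inf_mono) auto
  show ?thesis
    using assms(1) sub holomorphic_on_subset[OF _ sub] tendsto_mono[OF le]
    unfolding right_inverse_on_def image_subset_iff by auto
qed

lemma V_transform_on_mono:
  assumes "V_transform_on \<mu> \<alpha> \<beta> v" "\<alpha>' \<le> \<alpha>" "\<beta> \<le> \<beta>'"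
  shows "V_transform_on \<mu> \<alpha>' \<beta>' v"
  using assms(1) right_inverse_on_mono[OF _ assms(2,3)] truncated_cone_mono[OF assms(2,3)]
  unfolding V_transform_on_def by blast

text \<open>Two right inverses both map points high up in a cone into a region where the reciprocal Cauchy
  transform is injective.\<close>
lemma (in real_distribution) right_inverse_unique:
  assumes f: "right_inverse_on M \<alpha> \<beta> f" and g: "right_inverse_on M \<alpha> \<beta> g" and \<alpha>: "\<alpha> > 0"
  shows "\<exists>\<beta>'\<ge>\<beta>. \<forall>z\<in>truncated_cone \<alpha> \<beta>'. f z = g z"
proof -
  obtain b where b: "b > 0" and inj: "\<And>z w. z \<in> truncated_cone (2 * \<alpha> + 1) b \<Longrightarrow> w \<in> truncated_cone (2 * \<alpha> + 1) b \<Longrightarrow>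
     cmod ((z - recip_cauchy M z) - (w - recip_cauchy M w)) \<le> 1 / 2 * cmod (z - w)"
    using recip_cauchy_nontangential[of "2 * \<alpha> + 1" "1 / 2"] \<alpha> by auto
  define r where "r = 1 / (2 * (1 + \<alpha>))"
  have r: "r > 0" "r * (1 + \<alpha>) \<le> 1 / 2" using \<alpha> by (auto simp: r_def field_simps)
  obtain b1 where b1: "b1 > 0" "\<And>z. z \<in> truncated_cone \<alpha> (max \<beta> b1) \<Longrightarrow> cmod (f z - z) \<le> r * cmod z"
    using f r(1) unfolding right_inverse_on_def truncated_cone_limit_iff[OF \<alpha>] by blast
  obtain b2 where b2: "b2 > 0" "\<And>z. z \<in> truncated_cone \<alpha> (max \<beta> b2) \<Longrightarrow> cmod (g z - z) \<le> r * cmod z"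
    using g r(1) unfolding right_inverse_on_def truncated_cone_limit_iff[OF \<alpha>] by blast
  define \<beta>' where "\<beta>' = max (max \<beta> (2 * b)) (max b1 b2)"
  show ?thesis
  proof (intro exI[of _ \<beta>'] conjI ballI)
    show "\<beta> \<le> \<beta>'" by (simp add: \<beta>'_def)
    fix z assume "z \<in> truncated_cone \<alpha> \<beta>'"
    then have z: "z \<in> truncated_cone \<alpha> \<beta>" "z \<in> truncated_cone \<alpha> (2 * b)"
        "z \<in> truncated_cone \<alpha> (max \<beta> b1)" "z \<in> truncated_cone \<alpha> (max \<beta> b2)"
      by (auto simp: \<beta>'_def truncated_cone_iff)
    have "f z \<in> truncated_cone (2 * \<alpha> + 1) b" "g z \<in> truncated_cone (2 * \<alpha> + 1) b"
      using truncated_cone_neighbour[OF z(2) \<alpha> _ r(2) _ b1(2)[OF z(3)]]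
        truncated_cone_neighbour[OF z(2) \<alpha> _ r(2) _ b2(2)[OF z(4)]] b r(1) by auto
    from inj[OF this] have "cmod (f z - g z) \<le> 1 / 2 * cmod (f z - g z)"
      using f g z(1) by (simp add: right_inverse_on_def)
    then show "f z = g z" by simp
  qed
qed

lemma (in real_distribution) V_transform_unique:
  assumes "V_transform_on M \<alpha> \<beta> u" "V_transform_on M \<alpha>' \<beta>' v" "\<alpha> > 0" "\<alpha>' > 0"
  shows "\<exists>\<beta>''\<ge>max \<beta> \<beta>'. \<forall>z\<in>truncated_cone (min \<alpha> \<alpha>') \<beta>''. u z = v z"
proof -
  let ?a = "min \<alpha> \<alpha>'" and ?b = "max \<beta> \<beta>'"
  have "V_transform_on M ?a ?b u" "V_transform_on M ?a ?b v"
    using assms by (auto intro: V_transform_on_mono)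
  then obtain f g where fg: "right_inverse_on M ?a ?b f" "right_inverse_on M ?a ?b g"
    "\<And>z. z \<in> truncated_cone ?a ?b \<Longrightarrow> u z = f z - z" "\<And>z. z \<in> truncated_cone ?a ?b \<Longrightarrow> v z = g z - z"
    unfolding V_transform_on_def by blast
  have "?a > 0" using assms by simp
  then obtain b where b: "b \<ge> ?b" "\<And>z. z \<in> truncated_cone ?a b \<Longrightarrow> f z = g z"
    using right_inverse_unique[OF fg(1,2)] by blast
  then show ?thesis
    using fg(3,4) truncated_cone_mono[OF order_refl b(1), of ?a] by (intro exI[of _ b]) (auto simp: subset_iff)
qed

text \<open>On a common cone both measures have the same right inverse f. The image of the cone
  under f is open, as f is injective, and the two reciprocal Cauchy transforms agree there, so the
  identity theorem applies.\<close>

lemma V_transform_determines_distribution: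
  assumes dist: "real_distribution M" "real_distribution N"
    and u: "V_transform_on M \<alpha> \<beta> u" and v: "V_transform_on N \<alpha>' \<beta>' v" and pos: "\<alpha> > 0" "\<alpha>' > 0" "\<alpha>'' > 0"
    and eq: "\<And>z. z \<in> truncated_cone \<alpha>'' \<beta>'' \<Longrightarrow> u z = v z"
  shows "M = N"
proof -
  interpret DM: real_distribution M by fact
  interpret DN: real_distribution N by fact
  \<comment> \<open>The 0 in the maximum makes b nonnegative, so that i (b + 1) witnesses that the
    common cone is nonempty.\<close>
  define a b where "a = min (min \<alpha> \<alpha>') \<alpha>''" and "b = max (max \<beta> \<beta>') (max \<beta>'' 0)"
  have a: "a > 0" using pos by (simp add: a_def)
  have "V_transform_on M a b u" by (rule V_transform_on_mono[OF u]) (auto simp: a_def b_def)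
  moreover have "V_transform_on N a b v" by (rule V_transform_on_mono[OF v]) (auto simp: a_def b_def)
  ultimately obtain f g where f: "right_inverse_on M a b f" and g: "right_inverse_on N a b g"
    and fg: "\<And>z. z \<in> truncated_cone a b \<Longrightarrow> u z = f z - z" "\<And>z. z \<in> truncated_cone a b \<Longrightarrow> v z = g z - z"
    unfolding V_transform_on_def by blast
  define U where "U = truncated_cone a b"
  have "truncated_cone a b \<subseteq> truncated_cone \<alpha>'' \<beta>''" by (rule truncated_cone_mono) (auto simp: a_def b_def)
  then have eq_fg: "f z = g z" if "z \<in> U" for z
    using eq[of z] fg[of z] that unfolding U_def by auto
  have F: "f holomorphic_on U" "f ` U \<subseteq> upper_half_plane"
      "\<And>z. z \<in> U \<Longrightarrow> recip_cauchy M (f z) = z" "\<And>z. z \<in> U \<Longrightarrow> recip_cauchy N (f z) = z"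
    using f g eq_fg unfolding right_inverse_on_def U_def by auto
  have "inj_on f U" by (rule inj_on_inverseI[of _ "recip_cauchy M"]) (rule F(3))
  then have op: "open (f ` U)" using F(1) by (intro open_mapping_thm3) (auto simp: U_def open_truncated_cone)
  have "b \<ge> 0" by (simp add: b_def)
  then have "Complex 0 (b + 1) \<in> U" unfolding U_def using a by (intro imaginary_in_truncated_cone) auto
  then have ne: "f ` U \<noteq> {}" by blast
  have "cauchy_transform M z = cauchy_transform N z" if z: "Im z > 0" for z
  proof (rule analytic_continuation_open[OF op open_upper_half_plane ne _ F(2)
      DM.holomorphic_cauchy_transform DN.holomorphic_cauchy_transform])
    show "connected upper_half_plane" by (rule convex_connected[OF convex_upper_half_plane])
    fix w assume "w \<in> f ` U"
    then have "recip_cauchy M w = recip_cauchy N w" using F(3,4) by auto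
    then show "cauchy_transform M w = cauchy_transform N w" by (simp add: recip_cauchy_def)
  qed (use z in \<open>simp add: upper_half_plane_iff\<close>)
  then show ?thesis by (rule cauchy_transform_determines_distribution[OF dist])
qed

text \<open>Two candidates for the convolution may come with different cones and different
  V-transforms of \<mu> and \<nu>. These agree high up in a common subcone, and so do their
  sums.\<close>

lemma free_conv_eqI:
  assumes dist: "real_distribution \<mu>" "real_distribution \<nu>" "real_distribution \<rho>"
    and conv: "is_free_conv \<mu> \<nu> \<rho>"
  shows "\<mu> \<boxplus> \<nu> = \<rho>"
  unfolding free_conv_def
proof (rule the_equality)
  show "\<rho> \<in> borel_probs \<and> is_free_conv \<mu> \<nu> \<rho>" using assms by (simp add: borel_probs_def)
  fix \<rho>' assume \<rho>': "\<rho>' \<in> borel_probs \<and> is_free_conv \<mu> \<nu> \<rho>'"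
  interpret D\<mu>: real_distribution \<mu> by fact
  interpret D\<nu>: real_distribution \<nu> by fact
  obtain \<alpha> \<beta> u v w where 1: "\<alpha> > 0" "V_transform_on \<mu> \<alpha> \<beta> u" "V_transform_on \<nu> \<alpha> \<beta> v" "V_transform_on \<rho> \<alpha> \<beta> w"
      "\<And>z. z \<in> truncated_cone \<alpha> \<beta> \<Longrightarrow> w z = u z + v z"
    using conv unfolding is_free_conv_def by blast
  obtain \<alpha>' \<beta>' u' v' w' where 2: "\<alpha>' > 0" "V_transform_on \<mu> \<alpha>' \<beta>' u'" "V_transform_on \<nu> \<alpha>' \<beta>' v'" "V_transform_on \<rho>' \<alpha>' \<beta>' w'"
      "\<And>z. z \<in> truncated_cone \<alpha>' \<beta>' \<Longrightarrow> w' z = u' z + v' z"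
    using \<rho>' unfolding is_free_conv_def by blast
  let ?a = "min \<alpha> \<alpha>'"
  obtain b1 where b1: "b1 \<ge> max \<beta> \<beta>'" "\<And>z. z \<in> truncated_cone ?a b1 \<Longrightarrow> u z = u' z"
    using D\<mu>.V_transform_unique[OF 1(2) 2(2) 1(1) 2(1)] by blast
  obtain b2 where b2: "b2 \<ge> max \<beta> \<beta>'" "\<And>z. z \<in> truncated_cone ?a b2 \<Longrightarrow> v z = v' z"
    using D\<nu>.V_transform_unique[OF 1(3) 2(3) 1(1) 2(1)] by blast
  show "\<rho>' = \<rho>"
  proof (rule V_transform_determines_distribution[OF _ dist(3) 2(4) 1(4) 2(1) 1(1)])
    show "real_distribution \<rho>'" using \<rho>' by (simp add: borel_probs_def)
    show "?a > 0" using 1(1) 2(1) by simp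
    fix z assume z: "z \<in> truncated_cone ?a (max b1 b2)"
    have "truncated_cone ?a (max b1 b2) \<subseteq> truncated_cone \<alpha> \<beta>" "truncated_cone ?a (max b1 b2) \<subseteq> truncated_cone \<alpha>' \<beta>'"
      "truncated_cone ?a (max b1 b2) \<subseteq> truncated_cone ?a b1" "truncated_cone ?a (max b1 b2) \<subseteq> truncated_cone ?a b2"
      using b1(1) b2(1) by (intro truncated_cone_mono; auto)+
    then show "w' z = w z" using z 1(5) 2(5) b1(2) b2(2) by (metis subsetD)
  qed
qed

section \<open>Existence of right inverses and of measures with V-transform c (z - F z)\<close>

context real_distribution
begin

text \<open>F is injective high up in the wider cone, so one inverse f is fixed there. For every r
  the contraction supplies a solution within r |z|, and injectivity identifies it with f z; this
  gives the limit at infinity.\<close>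

lemma right_inverse_exists:
  assumes \<alpha>: "\<alpha> > 0"
  obtains \<beta> f where "\<beta> > 0" "right_inverse_on M \<alpha> \<beta> f"
proof -
  obtain b where b: "b > 0" and lip: "\<And>z w. z \<in> truncated_cone (2 * \<alpha> + 1) b \<Longrightarrow> w \<in> truncated_cone (2 * \<alpha> + 1) b \<Longrightarrow>
     cmod ((z - recip_cauchy M z) - (w - recip_cauchy M w)) \<le> 1 / 2 * cmod (z - w)"
    using recip_cauchy_nontangential[of "2 * \<alpha> + 1" "1 / 2"] \<alpha> by auto
  let ?U = "truncated_cone (2 * \<alpha> + 1) b"
  have inj: "inj_on (recip_cauchy M) ?U"
  proof (rule inj_onI)
    fix z w assume "z \<in> ?U" "w \<in> ?U" "recip_cauchy M z = recip_cauchy M w"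
    with lip[of z w] have "cmod (z - w) \<le> 1 / 2 * cmod (z - w)" by simp
    then show "z = w" by simp
  qed
  have hol: "recip_cauchy M holomorphic_on ?U"
    by (rule holomorphic_on_subset[OF holomorphic_recip_cauchy]) (auto simp: truncated_cone_def)
  obtain f where f: "f holomorphic_on recip_cauchy M ` ?U" "\<And>w. w \<in> ?U \<Longrightarrow> f (recip_cauchy M w) = w"
    using holomorphic_has_inverse[OF hol open_truncated_cone inj] by metis
  have solve: "\<exists>\<beta>>0. \<forall>z\<in>truncated_cone \<alpha> \<beta>. cmod (f z - z) \<le> r * cmod z \<and> f z \<in> ?U \<and> recip_cauchy M (f z) = z"
    if r: "r > 0" for r
  proof -
    \<comment> \<open>With c = -1 the perturbed identity w + c (w - F w) is F itself.\<close>
    obtain \<beta> where \<beta>: "\<beta> > 0" "\<And>z. z \<in> truncated_cone \<alpha> \<beta> \<Longrightarrow> \<exists>w\<in>?U. cmod (w - z) \<le> r * cmod z \<and>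
        w + of_real (- 1) * (w - recip_cauchy M w) = z"
      using perturbed_identity_solvable[OF \<alpha> r b, of "- 1"] by blast
    have "cmod (f z - z) \<le> r * cmod z \<and> f z \<in> ?U \<and> recip_cauchy M (f z) = z" if z: "z \<in> truncated_cone \<alpha> \<beta>" for z
      using \<beta>(2)[OF z] f(2) by auto
    then show ?thesis using \<beta>(1) by blast
  qed
  obtain \<beta> where \<beta>: "\<beta> > 0" "\<And>z. z \<in> truncated_cone \<alpha> \<beta> \<Longrightarrow> f z \<in> ?U \<and> recip_cauchy M (f z) = z"
    using solve[OF zero_less_one] by blast
  have "right_inverse_on M \<alpha> \<beta> f"
    unfolding right_inverse_on_def truncated_cone_limit_iff[OF \<alpha>]
  proof (intro conjI allI impI ballI)
    have "truncated_cone \<alpha> \<beta> \<subseteq> recip_cauchy M ` ?U"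
    proof
      fix z assume "z \<in> truncated_cone \<alpha> \<beta>"
      then show "z \<in> recip_cauchy M ` ?U" using \<beta>(2)[of z] by (intro image_eqI[of _ _ "f z"]) auto
    qed
    then show "f holomorphic_on truncated_cone \<alpha> \<beta>" by (rule holomorphic_on_subset[OF f(1)])
    show "f ` truncated_cone \<alpha> \<beta> \<subseteq> upper_half_plane" using \<beta>(2) by (auto simp: truncated_cone_def)
    show "recip_cauchy M (f z) = z" if "z \<in> truncated_cone \<alpha> \<beta>" for z using \<beta>(2)[OF that] by simp
    fix r :: real assume "r > 0"
    then obtain \<beta>' where "\<beta>' > 0" "\<And>z. z \<in> truncated_cone \<alpha> \<beta>' \<Longrightarrow> cmod (f z - z) \<le> r * cmod z"
      using solve by blast
    then show "\<exists>\<beta>'>0. \<forall>z\<in>truncated_cone \<alpha> (max \<beta> \<beta>'). cmod (f z - z) \<le> r * cmod z"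
      by (intro exI[of _ \<beta>']) (auto simp: truncated_cone_iff)
  qed
  then show ?thesis using that \<beta>(1) by blast
qed

text \<open>The subordination function \<omega> meets the conditions for a reciprocal Cauchy
  transform, say of \<nu>. It inverts z + c (z - F z), so this map is the right inverse belonging to
  \<nu> and c (z - F z) is its V-transform.\<close>

lemma scaled_V_transform_exists:
  assumes c: "c > 0"
  obtains \<nu> where "real_distribution \<nu>"
    "\<And>z. Im z > 0 \<Longrightarrow> recip_cauchy \<nu> z + of_real c * (recip_cauchy \<nu> z - recip_cauchy M (recip_cauchy \<nu> z)) = z"
    "\<And>w. Im w > 0 \<Longrightarrow> Im (w + of_real c * (w - recip_cauchy M w)) > 0 \<Longrightarrow>
       recip_cauchy \<nu> (w + of_real c * (w - recip_cauchy M w)) = w"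
    "\<And>z. Im z > 0 \<Longrightarrow> Im (recip_cauchy \<nu> z) \<ge> Im z"
    "\<And>r. r > 0 \<Longrightarrow> \<exists>\<beta>>0. \<forall>z\<in>truncated_cone 1 \<beta>. cmod (recip_cauchy \<nu> z - z) \<le> r * cmod z"
    "\<exists>\<beta>>0. V_transform_on \<nu> 1 \<beta> (\<lambda>z. of_real c * (z - recip_cauchy M z))"
proof -
  obtain \<omega> where \<omega>: "\<omega> holomorphic_on upper_half_plane"
    "\<And>z. Im z > 0 \<Longrightarrow> Im (\<omega> z) \<ge> Im z"
    "\<And>z. Im z > 0 \<Longrightarrow> \<omega> z + of_real c * (\<omega> z - recip_cauchy M (\<omega> z)) = z"
    "\<And>w. Im w > 0 \<Longrightarrow> Im (w + of_real c * (w - recip_cauchy M w)) > 0 \<Longrightarrow>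
       \<omega> (w + of_real c * (w - recip_cauchy M w)) = w"
    "\<And>\<alpha> r. \<alpha> > 0 \<Longrightarrow> r > 0 \<Longrightarrow> \<exists>\<beta>>0. \<forall>z\<in>truncated_cone \<alpha> \<beta>. cmod (\<omega> z - z) \<le> r * cmod z"
    using subordination_function_exists[OF c] by blast
  obtain \<nu> where \<nu>: "real_distribution \<nu>" "\<And>z. Im z > 0 \<Longrightarrow> recip_cauchy \<nu> z = \<omega> z"
    using reciprocal_cauchy_transform_exists[OF \<omega>(1,2) imaginary_axis_limit[OF \<omega>(5)[OF zero_less_one]]] by blast
  have h: "\<exists>\<beta>>0. \<forall>z\<in>truncated_cone 1 \<beta>. cmod (z + of_real c * (z - recip_cauchy M z) - z) \<le> r * cmod z"
    if r: "r > 0" for r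
  proof -
    obtain \<beta> where \<beta>: "\<beta> > 0" "\<And>z. z \<in> truncated_cone 1 \<beta> \<Longrightarrow> cmod (z - recip_cauchy M z) \<le> r / c * cmod z"
      using recip_cauchy_nontangential[of 1 "r / c"] r c by auto
    have "cmod (z + of_real c * (z - recip_cauchy M z) - z) \<le> r * cmod z" if "z \<in> truncated_cone 1 \<beta>" for z
      using mult_left_mono[OF \<beta>(2)[OF that], of c] c by (simp add: norm_mult)
    then show ?thesis using \<beta>(1) by blast
  qed
  obtain \<beta> where \<beta>: "\<beta> > 0" "\<And>z. z \<in> truncated_cone 1 \<beta> \<Longrightarrow> cmod (z + of_real c * (z - recip_cauchy M z) - z) \<le> 1 / 4 * cmod z"
    using h[of "1 / 4"] by auto
  have Im_pos: "Im (z + of_real c * (z - recip_cauchy M z)) > 0" if "z \<in> truncated_cone 1 \<beta>" for z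
    using truncated_cone_neighbour[OF that _ _ _ _ \<beta>(2)[OF that]] \<beta>(1) by (auto simp: truncated_cone_iff)
  have "right_inverse_on \<nu> 1 \<beta> (\<lambda>z. z + of_real c * (z - recip_cauchy M z))"
    unfolding right_inverse_on_def truncated_cone_limit_iff[OF zero_less_one]
  proof (intro conjI allI impI ballI)
    show "(\<lambda>z. z + of_real c * (z - recip_cauchy M z)) holomorphic_on truncated_cone 1 \<beta>"
      by (intro holomorphic_intros holomorphic_on_subset[OF holomorphic_recip_cauchy]) (auto simp: truncated_cone_def)
    show "(\<lambda>z. z + of_real c * (z - recip_cauchy M z)) ` truncated_cone 1 \<beta> \<subseteq> upper_half_plane"
      using Im_pos by (auto simp only: upper_half_plane_iff image_subset_iff)
    show "recip_cauchy \<nu> (z + of_real c * (z - recip_cauchy M z)) = z" if z: "z \<in> truncated_cone 1 \<beta>" for z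
      using \<nu>(2)[OF Im_pos[OF z]] \<omega>(4)[OF _ Im_pos[OF z]] z by (simp add: truncated_cone_iff)
    fix r :: real assume "r > 0"
    then obtain \<beta>' where "\<beta>' > 0"
        "\<And>z. z \<in> truncated_cone 1 \<beta>' \<Longrightarrow> cmod (z + of_real c * (z - recip_cauchy M z) - z) \<le> r * cmod z"
      using h by blast
    then show "\<exists>\<beta>'>0. \<forall>z\<in>truncated_cone 1 (max \<beta> \<beta>'). cmod (z + of_real c * (z - recip_cauchy M z) - z) \<le> r * cmod z"
      by (intro exI[of _ \<beta>']) (auto simp: truncated_cone_iff)
  qed
  then have V: "V_transform_on \<nu> 1 \<beta> (\<lambda>z. of_real c * (z - recip_cauchy M z))"
    unfolding V_transform_on_def by (intro exI[of _ "\<lambda>z. z + of_real c * (z - recip_cauchy M z)"]) auto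
  show ?thesis
  proof (rule that[OF \<nu>(1)])
    fix z assume z: "Im z > 0"
    show "recip_cauchy \<nu> z + of_real c * (recip_cauchy \<nu> z - recip_cauchy M (recip_cauchy \<nu> z)) = z"
      "Im (recip_cauchy \<nu> z) \<ge> Im z"
      using \<nu>(2)[OF z] \<omega>(2,3)[OF z] by auto
  next
    fix w assume w: "Im w > 0" "Im (w + of_real c * (w - recip_cauchy M w)) > 0"
    show "recip_cauchy \<nu> (w + of_real c * (w - recip_cauchy M w)) = w"
      using \<nu>(2)[OF w(2)] \<omega>(4)[OF w] by simp
  next
    fix r :: real assume "r > 0"
    then obtain \<beta> where "\<beta> > 0" "\<And>z. z \<in> truncated_cone 1 \<beta> \<Longrightarrow> cmod (\<omega> z - z) \<le> r * cmod z"
      using \<omega>(5)[OF zero_less_one] by blast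
    then show "\<exists>\<beta>>0. \<forall>z\<in>truncated_cone 1 \<beta>. cmod (recip_cauchy \<nu> z - z) \<le> r * cmod z"
      by (intro exI[of _ \<beta>]) (auto simp: \<nu>(2) truncated_cone_iff)
  next
    show "\<exists>\<beta>>0. V_transform_on \<nu> 1 \<beta> (\<lambda>z. of_real c * (z - recip_cauchy M z))" using V \<beta>(1) by blast
  qed
qed

end

section \<open>The Boolean Bercovici-Pata bijection\<close>

theorem theorem2:
  fixes \<mu> :: "real measure"
  assumes "\<mu> \<in> borel_probs"
  shows "B_one \<mu> = boolean_bercovici_pata \<mu>"
proof -
  interpret D: real_distribution \<mu> using assms by (simp add: borel_probs_def)
  let ?F = "recip_cauchy \<mu>"
  let ?h = "\<lambda>c z. complex_of_real c * (z - ?F z)"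
  have "\<forall>c. \<exists>\<nu>. c > 0 \<longrightarrow> real_distribution \<nu> \<and> (\<exists>\<beta>>0. V_transform_on \<nu> 1 \<beta> (?h c))"
    using D.scaled_V_transform_exists by metis
  then obtain N where N: "\<And>c. c > 0 \<Longrightarrow> real_distribution (N c)"
    and N_V: "\<And>c. c > 0 \<Longrightarrow> \<exists>\<beta>>0. V_transform_on (N c) 1 \<beta> (?h c)"
    by metis
  have N_unique: "\<nu> = N c" if c: "c > 0" and \<nu>: "real_distribution \<nu>" "V_transform_on \<nu> \<alpha> \<beta> v" "\<alpha> > 0"
      and v: "\<And>z. z \<in> truncated_cone 1 0 \<Longrightarrow> v z = ?h c z" for c \<nu> \<alpha> \<beta> v
  proof -
    obtain \<beta>' where "V_transform_on (N c) 1 \<beta>' (?h c)" using N_V[OF c] by blast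
    from V_transform_determines_distribution[OF \<nu>(1) N[OF c] \<nu>(2) this \<nu>(3) zero_less_one zero_less_one v]
    show ?thesis .
  qed
  \<comment> \<open>The V-transform \<open>?h c\<close> is additive in c, so \<open>N\<close> is a
    one-parameter semigroup under free convolution.\<close>
  have N_add: "N c \<boxplus> N d = N (c + d)" if c: "c > 0" and d: "d > 0" for c d
  proof (rule free_conv_eqI)
    have cd: "c + d > 0" using c d by simp
    obtain \<beta>1 where 1: "\<beta>1 > 0" "V_transform_on (N c) 1 \<beta>1 (?h c)" using N_V[OF c] by blast
    obtain \<beta>2 where 2: "\<beta>2 > 0" "V_transform_on (N d) 1 \<beta>2 (?h d)" using N_V[OF d] by blast
    obtain \<beta>3 where 3: "\<beta>3 > 0" "V_transform_on (N (c + d)) 1 \<beta>3 (?h (c + d))"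
      using N_V[OF cd] by blast
    define \<beta> where "\<beta> = max \<beta>1 (max \<beta>2 \<beta>3)"
    have "V_transform_on (N c) 1 \<beta> (?h c)" "V_transform_on (N d) 1 \<beta> (?h d)" "V_transform_on (N (c + d)) 1 \<beta> (?h (c + d))"
      by (rule V_transform_on_mono[OF 1(2)] V_transform_on_mono[OF 2(2)] V_transform_on_mono[OF 3(2)];
          simp add: \<beta>_def)+
    moreover have "\<beta> > 0" using 1 by (simp add: \<beta>_def)
    moreover have "?h (c + d) z = ?h c z + ?h d z" for z by (simp add: algebra_simps)
    ultimately show "is_free_conv (N c) (N d) (N (c + d))"
      unfolding is_free_conv_def using zero_less_one by blast
  qed (use N c d in auto)
  \<comment> \<open>k iterations multiply k + 1 factors, which matches the exponent n - 1 in
    \<open>free_conv_power\<close>.\<close>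
  have N_power: "((\<lambda>\<rho>. \<rho> \<boxplus> N c) ^^ k) (N c) = N (real (Suc k) * c)" if c: "c > 0" for c k
  proof (induction k)
    case (Suc k)
    have "0 < real (Suc k) * c" using c by simp
    moreover have "real (Suc k) * c + c = real (Suc (Suc k)) * c" by (simp add: algebra_simps)
    ultimately show ?case using N_add[of "real (Suc k) * c" c] c Suc.IH by simp
  qed simp
  have inf_div: "N 1 \<in> free_inf_div"
    unfolding free_inf_div_def
  proof (intro CollectI conjI allI impI)
    show "N 1 \<in> borel_probs" using N by (simp add: borel_probs_def)
    fix n :: nat assume n: "1 \<le> n"
    have "free_conv_power (N (1 / real n)) n = N 1"
      unfolding free_conv_power_def using N_power[of "1 / real n" "n - 1"] n by simp
    moreover have "N (1 / real n) \<in> borel_probs" using N n by (simp add: borel_probs_def)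
    ultimately show "\<exists>\<mu>\<^sub>n\<in>borel_probs. free_conv_power \<mu>\<^sub>n n = N 1" by blast
  qed
  have bp: "boolean_bercovici_pata \<mu> = N 1"
    unfolding boolean_bercovici_pata_def
  proof (rule the_equality)
    obtain \<beta> where "\<beta> > 0" "V_transform_on (N 1) 1 \<beta> (?h 1)" using N_V[OF zero_less_one] by blast
    moreover have "?h 1 holomorphic_on upper_half_plane"
      by (intro holomorphic_intros D.holomorphic_recip_cauchy)
    ultimately have "V_transform_extension (N 1) (?h 1)"
      unfolding V_transform_extension_def using zero_less_one by blast
    then show "N 1 \<in> free_inf_div \<and> (\<exists>v. V_transform_extension (N 1) v \<and> (\<forall>z\<in>upper_half_plane. z - ?F z = v z))"
      using inf_div by (intro conjI exI[of _ "?h 1"]) auto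
    fix \<nu> assume "\<nu> \<in> free_inf_div \<and> (\<exists>v. V_transform_extension \<nu> v \<and> (\<forall>z\<in>upper_half_plane. z - ?F z = v z))"
    then obtain v \<alpha> \<beta> where \<nu>: "real_distribution \<nu>" "\<alpha> > 0" "V_transform_on \<nu> \<alpha> \<beta> v"
      and v: "\<And>z. z \<in> upper_half_plane \<Longrightarrow> z - ?F z = v z"
      unfolding V_transform_extension_def free_inf_div_def borel_probs_def by blast
    show "\<nu> = N 1"
    proof (rule N_unique[OF zero_less_one \<nu>(1,3,2)])
      show "v z = ?h 1 z" if "z \<in> truncated_cone 1 0" for z
        using v[of z] that by (simp add: truncated_cone_def)
    qed
  qed

  \<comment> \<open>\<open>N\<close> records only V-transforms. Here the functional equation and the
    asymptotics are wanted as well; uniqueness then identifies \<nu> with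
    \<open>N 1\<close>.\<close>
  obtain \<nu> where \<nu>: "real_distribution \<nu>"
    and sol: "\<And>z. Im z > 0 \<Longrightarrow> recip_cauchy \<nu> z + of_real 1 * (recip_cauchy \<nu> z - ?F (recip_cauchy \<nu> z)) = z"
    and left: "\<And>w. Im w > 0 \<Longrightarrow> Im (w + of_real 1 * (w - ?F w)) > 0 \<Longrightarrow> recip_cauchy \<nu> (w + of_real 1 * (w - ?F w)) = w"
    and Im_ge: "\<And>z. Im z > 0 \<Longrightarrow> Im (recip_cauchy \<nu> z) \<ge> Im z"
    and near: "\<And>r. r > 0 \<Longrightarrow> \<exists>\<beta>>0. \<forall>z\<in>truncated_cone 1 \<beta>. cmod (recip_cauchy \<nu> z - z) \<le> r * cmod z"
    and V: "\<exists>\<beta>>0. V_transform_on \<nu> 1 \<beta> (?h 1)"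
    by (rule D.scaled_V_transform_exists[OF zero_less_one]) blast
  have \<nu>_N: "\<nu> = N 1"
    using V N_unique[OF zero_less_one \<nu> _ zero_less_one] by blast
  interpret D\<nu>: real_distribution \<nu> by (rule \<nu>)
  have F\<nu>: "?F (recip_cauchy \<nu> z) = 2 * recip_cauchy \<nu> z - z" if "Im z > 0" for z
    using sol[OF that] by (simp add: algebra_simps)

  \<comment> \<open>The candidate for the free convolution square. The composite form gives the
    bound on imaginary parts, the form \<open>2 * recip_cauchy \<nu> z - z\<close> the limit at
    infinity.\<close>
  obtain \<rho> where \<rho>: "real_distribution \<rho>" and F\<rho>: "\<And>z. Im z > 0 \<Longrightarrow> recip_cauchy \<rho> z = ?F (recip_cauchy \<nu> z)"
  proof (rule reciprocal_cauchy_transform_exists[of "\<lambda>z. ?F (recip_cauchy \<nu> z)"])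
    have "(?F \<circ> recip_cauchy \<nu>) holomorphic_on upper_half_plane"
      using Im_ge by (intro holomorphic_on_compose_gen[OF D\<nu>.holomorphic_recip_cauchy D.holomorphic_recip_cauchy])
        (force simp: upper_half_plane_iff)
    then show "(\<lambda>z. ?F (recip_cauchy \<nu> z)) holomorphic_on upper_half_plane" by (simp add: comp_def)
    show "Im (?F (recip_cauchy \<nu> z)) \<ge> Im z" if "Im z > 0" for z
      using D.Im_recip_cauchy_ge[of "recip_cauchy \<nu> z"] Im_ge[OF that] that by linarith
    show "((\<lambda>y. ?F (recip_cauchy \<nu> (Complex 0 y)) / Complex 0 y) \<longlongrightarrow> 1) at_top"
    proof (rule imaginary_axis_limit)
      fix r :: real assume "r > 0"
      then obtain \<beta> where \<beta>: "\<beta> > 0" "\<And>z. z \<in> truncated_cone 1 \<beta> \<Longrightarrow> cmod (recip_cauchy \<nu> z - z) \<le> r / 2 * cmod z"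
        using near[of "r / 2"] by auto
      have "cmod (?F (recip_cauchy \<nu> z) - z) \<le> r * cmod z" if z: "z \<in> truncated_cone 1 \<beta>" for z
      proof -
        have eq: "?F (recip_cauchy \<nu> z) - z = 2 * (recip_cauchy \<nu> z - z)"
          using F\<nu>[of z] z by (simp add: truncated_cone_iff)
        show ?thesis unfolding eq norm_mult using \<beta>(2)[OF z] by simp
      qed
      then show "\<exists>\<beta>>0. \<forall>z\<in>truncated_cone 1 \<beta>. cmod (?F (recip_cauchy \<nu> z) - z) \<le> r * cmod z"
        using \<beta>(1) by blast
    qed
  qed blast

  have "is_free_conv \<mu> \<mu> \<rho>"
  proof -
    obtain \<beta>0 f where f0: "\<beta>0 > 0" "right_inverse_on \<mu> 1 \<beta>0 f"
      using D.right_inverse_exists[OF zero_less_one] by blast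
    have f_near: "\<exists>\<beta>'>0. \<forall>z\<in>truncated_cone 1 (max \<beta>0 \<beta>'). cmod (f z - z) \<le> r * cmod z" if "r > 0" for r
      using f0(2) that unfolding right_inverse_on_def truncated_cone_limit_iff[OF zero_less_one] by blast
    then obtain \<beta>1 where \<beta>1: "\<beta>1 > 0" "\<And>z. z \<in> truncated_cone 1 (max \<beta>0 \<beta>1) \<Longrightarrow> cmod (f z - z) \<le> 1 / 8 * cmod z"
      using f_near[of "1 / 8"] by auto
    define \<beta> where "\<beta> = max \<beta>0 \<beta>1"
    have \<beta>: "\<beta> > 0" using f0(1) by (simp add: \<beta>_def)
    have f: "right_inverse_on \<mu> 1 \<beta> f" by (rule right_inverse_on_mono[OF f0(2)]) (auto simp: \<beta>_def)
    have Im_f: "Im (f z) > 0" if "z \<in> truncated_cone 1 \<beta>" for z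
      using f that by (auto simp: right_inverse_on_def upper_half_plane_iff)
    have k_near: "cmod (2 * f z - z - z) = 2 * cmod (f z - z)" for z
      using norm_mult[of 2 "f z - z"] by (simp add: algebra_simps)
    have Im_k: "Im (2 * f z - z) > 0" if z: "z \<in> truncated_cone 1 \<beta>" for z
    proof -
      have "cmod (2 * f z - z - z) \<le> 1 / 4 * cmod z"
        using \<beta>1(2)[of z] z unfolding k_near \<beta>_def by simp
      from truncated_cone_neighbour[OF z _ _ _ _ this] show ?thesis using \<beta> by (simp add: truncated_cone_iff)
    qed
    have "right_inverse_on \<rho> 1 \<beta> (\<lambda>z. 2 * f z - z)"
      unfolding right_inverse_on_def truncated_cone_limit_iff[OF zero_less_one]
    proof (intro conjI allI impI ballI)
      show "(\<lambda>z. 2 * f z - z) holomorphic_on truncated_cone 1 \<beta>"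
        using f by (intro holomorphic_intros) (simp add: right_inverse_on_def)
      show "(\<lambda>z. 2 * f z - z) ` truncated_cone 1 \<beta> \<subseteq> upper_half_plane"
        using Im_k by (auto simp only: upper_half_plane_iff image_subset_iff)
      fix z assume z: "z \<in> truncated_cone 1 \<beta>"
      have Ff: "?F (f z) = z" using f z by (simp add: right_inverse_on_def)
      \<comment> \<open>The point \<open>2 * f z - z\<close> is the image of f z under w + (w - F
        w). Hence \<nu> sends it back to f z, and \<rho> sends it to F (f z) = z.\<close>
      have k: "f z + of_real 1 * (f z - ?F (f z)) = 2 * f z - z" unfolding Ff by simp
      have "recip_cauchy \<nu> (2 * f z - z) = f z"
        using left[OF Im_f[OF z]] Im_k[OF z] unfolding k by blast
      then show "recip_cauchy \<rho> (2 * f z - z) = z" using F\<rho>[OF Im_k[OF z]] Ff by simp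
    next
      fix r :: real assume "r > 0"
      then obtain \<beta>' where "\<beta>' > 0" "\<And>z. z \<in> truncated_cone 1 (max \<beta>0 \<beta>') \<Longrightarrow> cmod (f z - z) \<le> r / 2 * cmod z"
        using f_near[of "r / 2"] by auto
      then show "\<exists>\<beta>'>0. \<forall>z\<in>truncated_cone 1 (max \<beta> \<beta>'). cmod (2 * f z - z - z) \<le> r * cmod z"
        unfolding k_near by (intro exI[of _ \<beta>']) (fastforce simp: truncated_cone_iff \<beta>_def)
    qed
    then have "V_transform_on \<rho> 1 \<beta> (\<lambda>z. (f z - z) + (f z - z))"
      unfolding V_transform_on_def by (intro exI[of _ "\<lambda>z. 2 * f z - z"]) auto
    moreover have "V_transform_on \<mu> 1 \<beta> (\<lambda>z. f z - z)"
      unfolding V_transform_on_def using f by blast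
    ultimately show ?thesis
      unfolding is_free_conv_def using \<beta> zero_less_one by blast
  qed
  then have conv: "\<mu> \<boxplus> \<mu> = \<rho>"
    by (intro free_conv_eqI \<rho>) (use assms in \<open>simp_all add: borel_probs_def\<close>)
  \<comment> \<open>The Boolean square root averages the reciprocal Cauchy transform with the
    identity, which cancels the - z in \<open>F\<nu>\<close>.\<close>
  have half: "of_real (1 / 2) * recip_cauchy \<rho> z + of_real (1 - 1 / 2) * z = recip_cauchy \<nu> z" if "Im z > 0" for z
    using F\<rho>[OF that] F\<nu>[OF that] by (simp add: field_simps)
  have "B_one \<mu> = \<nu>"
    unfolding B_one_def boolean_power_def conv
  proof (rule the_equality)
    show "\<nu> \<in> borel_probs \<and> (\<forall>z\<in>upper_half_plane.
        recip_cauchy \<nu> z = of_real (1 / 2) * recip_cauchy \<rho> z + of_real (1 - 1 / 2) * z)"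
      using \<nu> half by (auto simp only: borel_probs_def upper_half_plane_iff mem_Collect_eq)
    fix \<nu>' assume \<nu>': "\<nu>' \<in> borel_probs \<and> (\<forall>z\<in>upper_half_plane.
        recip_cauchy \<nu>' z = of_real (1 / 2) * recip_cauchy \<rho> z + of_real (1 - 1 / 2) * z)"
    show "\<nu>' = \<nu>"
    proof (rule cauchy_transform_determines_distribution[OF _ \<nu>])
      show "real_distribution \<nu>'" using \<nu>' by (simp add: borel_probs_def)
      fix z :: complex assume z: "Im z > 0"
      then have "recip_cauchy \<nu>' z = recip_cauchy \<nu> z" using \<nu>' half[OF z] by (simp only: upper_half_plane_iff)
      then show "cauchy_transform \<nu>' z = cauchy_transform \<nu> z" by (simp add: recip_cauchy_def)
    qed
  qed
  then show ?thesis by (simp add: bp \<nu>_N)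
qed

end
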